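(* Let $P$ be the transition kernel on $\mathcal{X}=\mathbb{R}^2$ of the Metropolis–Hastings algorithm (described in the context) with proposals uniform on the annulus $B_x=\{z\in\mathbb{R}^2:|\,\|x\|-1|<\|z\|<\|x\|+1\}$, for the unnormalized density $\pi(x)=e^{-H(x)}$, $H(x)=\|x\|+\frac{1}{\|x\|}$. Let $C=\{x\in\mathbb{R}^2:\frac14\le\|x\|\le 4\}$ and $V(x)=e^{\frac12 H(x)}$. Then: (a) there is a probability measure $Q$ on $\mathbb{R}^2$ such that $$P^2(x,\cdot)\ \ge\ (3.5\times10^{-5})\,Q(\cdot)\qquad\text{for all }x\in C;$$ (b) the drift condition $$PV(x)\ \le\ 0.995\,V(x)+(e^{2.7}-0.995)\,\mathbf{1}_C(x)\qquad\text{for all }x\in\mathcal{X}$$ holds, and furthermore $\sup_{x\in C}PV(x)\le e^{2.7}$. In particular, this chain is geometrically ergodic.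
   Context: $\|\cdot\|$ is the Euclidean norm on $\mathbb{R}^2$; $r_x=\|x\|$. The algorithm: from $x\neq 0$, a proposal $y$ is drawn from the uniform distribution on $B_x$, which has area $4\pi r_x$ (here $\pi$ is the number $3.14\ldots$), i.e. with proposal density $q(x,y)=\mathbf{1}_{B_x}(y)/(4\pi r_x)$. With probability $$\alpha(x,y)=\min\Big\{1,\frac{\pi(y)q(y,x)}{\pi(x)q(x,y)}\Big\}=\min\Big\{1,\frac{e^{H(x)}r_x}{e^{H(y)}r_y}\Big\}$$ the chain moves to $y$; otherwise it stays at $x$. (One has $y\in B_x$ iff $x\in B_y$.) The single point $x=0$ is a null set where $H(0)=V(0)=+\infty$ and $\pi(0)=0$; the kernel there may be defined arbitrarily. $PV(x)=E[V(X_1)\mid X_0=x]=\int V(y)P(x,dy)$. The stationary distribution, also written $\pi(\cdot)$, is the probability measure with Lebesgue density proportional to $e^{-H(x)}$. The chain is geometrically ergodic if there are a fixed $\rho<1$ and a $\pi$-a.e.-finite function $M:\mathcal{X}\to[0,\infty]$ with $\|P^n(x,\cdot)-\pi(\cdot)\|\le M(x)\rho^n$ for all $n\in\mathbb{N}$, $x\in\mathcal{X}$, where $\|\mu-\nu\|=\sup_S|\mu(S)-\nu(S)|$ is total variation distance. *)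

theory Defs
  imports "HOL-Probability.Probability"
begin

definition mh_accept :: "('a \<Rightarrow> real) \<Rightarrow> ('a \<Rightarrow> 'a \<Rightarrow> real) \<Rightarrow> 'a \<Rightarrow> 'a \<Rightarrow> real" where
  "mh_accept p q x y = min 1 (p y * q y x / (p x * q x y))"

(* The target density p need not be normalised, since it only enters through the ratio
   in mh_accept; q x is the Lebesgue density of the proposal from x. *)
definition mh_kernel ::
  "('a::euclidean_space \<Rightarrow> real) \<Rightarrow> ('a \<Rightarrow> 'a \<Rightarrow> real) \<Rightarrow> 'a \<Rightarrow> 'a measure" where
  "mh_kernel p q x =
     bind (density lborel (\<lambda>y. ennreal (q x y)))
       (\<lambda>y. bind (measure_pmf (bernoulli_pmf (mh_accept p q x y)))
         (\<lambda>accepted. return borel (if accepted then y else x)))"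

definition normalized_density :: "('a::euclidean_space \<Rightarrow> real) \<Rightarrow> 'a measure" where
  "normalized_density p =
     density lborel (\<lambda>x. ennreal (p x) / (\<integral>\<^sup>+ y. ennreal (p y) \<partial>lborel))"

primrec kernel_power ::
  "('a::topological_space \<Rightarrow> 'a measure) \<Rightarrow> nat \<Rightarrow> 'a \<Rightarrow> 'a measure" where
  "kernel_power P 0 x = return borel x"
| "kernel_power P (Suc n) x = bind (kernel_power P n x) P"

definition tv_distance ::
  "'a::topological_space measure \<Rightarrow> 'a measure \<Rightarrow> real" where
  "tv_distance \<mu> \<nu> = (SUP S\<in>sets borel. \<bar>measure \<mu> S - measure \<nu> S\<bar>)"

definition geometrically_ergodic ::
  "('a::topological_space \<Rightarrow> 'a measure) \<Rightarrow> 'a measure \<Rightarrow> bool" where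
  "geometrically_ergodic P \<mu> \<longleftrightarrow>
     (\<exists>(\<rho>::real) (M::'a \<Rightarrow> ennreal).
        0 \<le> \<rho> \<and> \<rho> < 1 \<and> (AE x in \<mu>. M x < \<infinity>) \<and>
        (\<forall>n x. ennreal (tv_distance (kernel_power P n x) \<mu>) \<le> M x * ennreal (\<rho> ^ n)))"

(* H is only meaningful away from the origin, where mathematically H 0 = \<infinity>; the resulting
   values of the density (0) and of the drift function (\<infinity>) at the origin are given explicitly. *)
definition H :: "real^2 \<Rightarrow> real" where
  "H x = norm x + 1 / norm x"

definition target_density :: "real^2 \<Rightarrow> real" where
  "target_density x = (if x = 0 then 0 else exp (- H x))"

definition V :: "real^2 \<Rightarrow> ennreal" where
  "V x = (if x = 0 then \<infinity> else ennreal (exp (H x / 2)))"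

definition B :: "real^2 \<Rightarrow> (real^2) set" where
  "B x = {z. \<bar>norm x - 1\<bar> < norm z \<and> norm z < norm x + 1}"

(* The annulus B x has area pi * ((norm x + 1)^2 - (norm x - 1)^2) = 4 * pi * norm x. *)
definition proposal_density :: "real^2 \<Rightarrow> real^2 \<Rightarrow> real" where
  "proposal_density x y = indicator (B x) y / (4 * pi * norm x)"

(* The law of the move from the origin is arbitrary, hence a parameter. *)
definition annulus_chain :: "(real^2) measure \<Rightarrow> real^2 \<Rightarrow> (real^2) measure" where
  "annulus_chain P0 x =
     (if x = 0 then P0 else mh_kernel target_density proposal_density x)"

definition C :: "(real^2) set" where
  "C = {x. 1/4 \<le> norm x \<and> norm x \<le> 4}"

end

theory Submission
  imports Defs
begin

text \<open>
  Write \<open>r\<close> and \<open>s\<close> for the norms of the current point and of the proposal, and \<open>h r = r + 1 / r\<close>.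
  The chain is rotation invariant: a uniform point of the annulus has a radius with density
  \<open>s / (2 * r)\<close> on \<open>(\<bar>r - 1\<bar>, r + 1)\<close>, and it is accepted with probability
  \<open>accept r s = min 1 (exp (h r - h s) * (r / s))\<close>.  Integrating in polar coordinates therefore turns
  \<open>PV / V\<close> into the integral of the explicit function \<open>drift_integrand r\<close>
  (\<open>nn_integral_V_annulus\<close>).

  Drift.  The contribution of a proposal to \<open>PV / V - 1\<close> never exceeds \<open>1 / 8\<close> per unit of radius,
  so \<open>PV \<le> 5/4 * V\<close> away from the origin, which suffices on \<open>C\<close>, where \<open>V \<le> exp (17 / 8)\<close>.
  For \<open>r < 1/4\<close> the proposal lies near the unit circle, where \<open>V\<close> is at most half as large, and it
  is accepted with probability at least \<open>1 / 30\<close>.  The delicate case is \<open>r > 4\<close>.  Inward proposals are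
  always accepted and outward ones only sometimes, but the gain is small: comparing
  \<open>h s - h r\<close> with fixed multiples of \<open>s - r\<close>, uniformly in \<open>r\<close>, leaves a net decrease of about
  \<open>0.0053\<close>, just enough for the required \<open>0.005\<close>.  The comparison functions have elementary
  antiderivatives, so this is settled by \<open>e < 2.72\<close> (\<open>far_drift_numeric\<close>, \<open>integral_drift_far\<close>).

  Minorization.  Two steps lead from every point of \<open>C\<close> to the thin annulus of radii \<open>33/16\<close> to
  \<open>17/8\<close>: from radii up to \<open>17/8\<close> through radii \<open>9/8\<close> to \<open>5/4\<close>, and from larger ones through radii
  \<open>3\<close> to \<open>49/16\<close>.  Bounding the transition densities on these routes from below by constants
  gives the claim with the uniform distribution on that annulus as \<open>Q\<close>.

  Geometric ergodicity is Harris' theorem (\<open>geometrically_ergodic_if_drift\<close>), proved in the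
  style of Hairer and Mattingly: test functions whose oscillation is controlled by
  \<open>2 + \<beta> V x + \<beta> V y\<close> are contracted.  This argument needs a minorization on a sublevel set of \<open>V\<close> whose
  height is of order \<open>b / (1 - g)^2\<close> for the drift constants \<open>g = 0.995\<close> and \<open>b = exp 2.7 - 0.995\<close>,
  a set far larger than \<open>C\<close>.  It is obtained by allowing more
  steps: from radius at most \<open>R + 1/2\<close>, with \<open>R \<ge> 4\<close>, one step leads to the shell of radii
  \<open>1/4\<close> to \<open>R\<close> with probability at least \<open>1 / 30\<close> (\<open>shell_step\<close>), so \<open>j\<close> more steps enlarge the
  small set \<open>C\<close> by \<open>j / 2\<close> in radius.  Invariance of the target is detailed balance.
\<close>

section \<open>Powers of Markov kernels\<close>

lemma kernel_power_measurable:
  fixes P :: "'a::topological_space \<Rightarrow> 'a measure"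
  assumes "P \<in> borel \<rightarrow>\<^sub>M prob_algebra borel"
  shows "kernel_power P n \<in> borel \<rightarrow>\<^sub>M prob_algebra borel"
proof (induction n)
  case 0
  have "kernel_power P 0 = return borel" by (simp add: fun_eq_iff)
  then show ?case by simp
next
  case (Suc n)
  have "kernel_power P (Suc n) = (\<lambda>x. bind (kernel_power P n x) P)" by (simp add: fun_eq_iff)
  then show ?case using measurable_bind_prob_space[OF Suc assms] by simp
qed

lemma kernel_prob_space:
  assumes "K \<in> borel \<rightarrow>\<^sub>M prob_algebra borel"
  shows "prob_space (K x)" "sets (K x) = sets borel" "space (K x) = UNIV"
proof -
  have "K x \<in> space (prob_algebra borel)"
    using assms by (rule measurable_space) simp
  then show "prob_space (K x)" and s: "sets (K x) = sets borel"
    by (auto simp: space_prob_algebra)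
  from sets_eq_imp_space_eq[OF s] show "space (K x) = UNIV" by simp
qed

lemma kernel_power_add:
  fixes P :: "'a::topological_space \<Rightarrow> 'a measure"
  assumes P: "P \<in> borel \<rightarrow>\<^sub>M prob_algebra borel"
  shows "kernel_power P (m + n) x = bind (kernel_power P m x) (kernel_power P n)"
proof (induction n)
  case 0
  have "kernel_power P 0 = return borel" by (simp add: fun_eq_iff)
  then show ?case
    using kernel_prob_space(2)[OF kernel_power_measurable[OF P]] by (simp add: bind_return'')
next
  case (Suc n)
  note Pn = kernel_power_measurable[OF P, of n]
  have "kernel_power P (m + Suc n) x = bind (bind (kernel_power P m x) (kernel_power P n)) P"
    using Suc by simp
  also have "\<dots> = bind (kernel_power P m x) (\<lambda>y. bind (kernel_power P n y) P)"
    using measurable_prob_algebraD[OF Pn] measurable_prob_algebraD[OF P]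
    by (intro bind_assoc[where N=borel and R=borel])
       (simp_all cong: measurable_cong_sets
          add: kernel_prob_space(2)[OF kernel_power_measurable[OF P]])
  also have "(\<lambda>y. bind (kernel_power P n y) P) = kernel_power P (Suc n)"
    by (simp add: fun_eq_iff)
  finally show ?case .
qed

lemma kernel_power_1:
  fixes P :: "'a::topological_space \<Rightarrow> 'a measure"
  assumes P: "P \<in> borel \<rightarrow>\<^sub>M prob_algebra borel"
  shows "kernel_power P (Suc 0) = P"
  using bind_return[OF measurable_prob_algebraD[OF P]] by (simp add: fun_eq_iff)

lemma nn_integral_bind_kernel:
  assumes "K \<in> borel \<rightarrow>\<^sub>M prob_algebra borel" "sets M = sets borel"
    and "f \<in> borel_measurable borel"
  shows "(\<integral>\<^sup>+ y. f y \<partial>bind M K) = (\<integral>\<^sup>+ x. (\<integral>\<^sup>+ y. f y \<partial>K x) \<partial>M)"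
  using assms(3) measurable_prob_algebraD[OF assms(1)]
  by (intro nn_integral_bind[where B=borel]) (simp_all cong: measurable_cong_sets add: assms(2))

lemma emeasure_kernel_power_Suc:
  fixes P :: "'a::topological_space \<Rightarrow> 'a measure"
  assumes P: "P \<in> borel \<rightarrow>\<^sub>M prob_algebra borel" and S: "S \<in> sets borel"
  shows "emeasure (kernel_power P (Suc n) x) S = (\<integral>\<^sup>+ y. emeasure (kernel_power P n y) S \<partial>P x)"
proof -
  have "kernel_power P (Suc n) x = bind (P x) (kernel_power P n)"
    using kernel_power_add[OF P, of "Suc 0" n x] by (simp only: kernel_power_1[OF P] add_Suc add_0)
  moreover have "P x \<in> space (prob_algebra borel)"
    using P by (rule measurable_space) simp
  ultimately show ?thesis
    using emeasure_bind_prob_algebra[OF _ kernel_power_measurable[OF P] S] by simp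
qed

lemma emeasure_kernel_measurable:
  fixes K :: "'a::topological_space \<Rightarrow> 'a measure"
  assumes "K \<in> borel \<rightarrow>\<^sub>M prob_algebra borel" "S \<in> sets borel"
  shows "(\<lambda>x. emeasure (K x) S) \<in> borel_measurable borel"
  using measurable_compose[OF measurable_prob_algebraD[OF assms(1)]
      measurable_emeasure_subprob_algebra[OF assms(2)]] .

text \<open>A minorization that holds on \<open>D\<close> after \<open>n\<close> steps holds after \<open>n + 1\<close> steps wherever one
  step enters \<open>D\<close> with a probability bounded from below, at the cost of that probability.\<close>
lemma minorization_extend:
  fixes P :: "'a::topological_space \<Rightarrow> 'a measure"
  assumes P: "P \<in> borel \<rightarrow>\<^sub>M prob_algebra borel" and S: "S \<in> sets borel" and D: "D \<in> sets borel"
    and e: "0 \<le> e" "\<And>y. y \<in> D \<Longrightarrow> ennreal e * emeasure Q S \<le> emeasure (kernel_power P n y) S"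
    and d: "0 \<le> d" "ennreal d \<le> emeasure (P x) D"
  shows "ennreal (d * e) * emeasure Q S \<le> emeasure (kernel_power P (Suc n) x) S"
proof -
  have D': "D \<in> sets (P x)" using D by (simp add: kernel_prob_space(2)[OF P])
  have "ennreal (d * e) * emeasure Q S = ennreal e * emeasure Q S * ennreal d"
    using e d by (simp add: ennreal_mult ac_simps)
  also have "\<dots> \<le> ennreal e * emeasure Q S * emeasure (P x) D" using d by (intro mult_left_mono) auto
  also have "\<dots> = (\<integral>\<^sup>+ y. ennreal e * emeasure Q S * indicator D y \<partial>P x)"
    by (rule nn_integral_cmult_indicator[OF D', symmetric])
  also have "\<dots> \<le> (\<integral>\<^sup>+ y. emeasure (kernel_power P n y) S \<partial>P x)"
    using e(2) by (intro nn_integral_mono) (auto split: split_indicator)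
  also have "\<dots> = emeasure (kernel_power P (Suc n) x) S"
    by (rule emeasure_kernel_power_Suc[OF P S, symmetric])
  finally show ?thesis .
qed

section \<open>Harris' theorem\<close>

lemma nn_integral_minorized:
  assumes "sets Q = sets M" "\<And>S. S \<in> sets M \<Longrightarrow> e * emeasure Q S \<le> emeasure M S"
    and "f \<in> borel_measurable M"
  shows "e * (\<integral>\<^sup>+ x. f x \<partial>Q) \<le> (\<integral>\<^sup>+ x. f x \<partial>M)"
proof -
  have "scale_measure e Q \<le> M"
    using assms sets_eq_imp_space_eq[OF assms(1)]
    by (auto simp: le_measure_iff le_fun_def space_scale_measure)
       (metis emeasure_notin_sets assms(1) mult_zero_right zero_le)
  then have "nn_integral (scale_measure e Q) f \<le> nn_integral M f"
    using assms(1) by (intro nn_integral_mono_measure) simp_all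
  then show ?thesis
    using assms(3) by (simp add: nn_integral_scale_measure measurable_cong_sets[OF assms(1)])
qed

text \<open>
  This replaces a coupling of \<open>\<mu>\<close> and \<open>\<nu>\<close>.  The hypothesis on \<open>\<phi>\<close> provides a constant \<open>c\<close> with
  \<open>\<bar>\<phi> - c\<bar> \<le> f\<close> on \<open>X\<close>, so that \<open>f - \<phi> + c\<close> and \<open>f + \<phi> - c\<close> are nonnegative.  The first is integrated
  against \<open>\<mu>\<close> and the second against \<open>\<nu>\<close>; each integral dominates \<open>e\<close> times the one against the
  common part \<open>Q\<close>, where the two functions add up to \<open>2 f \<ge> 2 a\<close>.
\<close>
lemma integral_difference_le:
  fixes \<phi> f :: "'a \<Rightarrow> real"
  assumes \<mu>: "prob_space \<mu>" and \<nu>: "prob_space \<nu>" and Q: "prob_space Q"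
    and sets: "sets \<nu> = sets \<mu>" "sets Q = sets \<mu>"
    and X: "AE x in \<mu>. x \<in> X" "AE x in \<nu>. x \<in> X"
    and \<phi>: "\<phi> \<in> borel_measurable \<mu>" "\<And>x. \<bar>\<phi> x\<bar> \<le> b"
    and f: "integrable \<mu> f" "integrable \<nu> f"
    and osc: "\<And>x y. x \<in> X \<Longrightarrow> y \<in> X \<Longrightarrow> \<phi> x - \<phi> y \<le> f x + f y"
    and e: "0 \<le> e" and a: "0 \<le> a" "\<And>x. a \<le> f x"
    and min: "\<And>S. S \<in> sets \<mu> \<Longrightarrow> ennreal e * emeasure Q S \<le> emeasure \<mu> S"
             "\<And>S. S \<in> sets \<mu> \<Longrightarrow> ennreal e * emeasure Q S \<le> emeasure \<nu> S"
  shows "(\<integral> x. \<phi> x \<partial>\<mu>) - (\<integral> x. \<phi> x \<partial>\<nu>) \<le> (\<integral> x. f x \<partial>\<mu>) + (\<integral> x. f x \<partial>\<nu>) - 2 * e * a"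
proof -
  interpret \<mu>: prob_space \<mu> by fact
  interpret \<nu>: prob_space \<nu> by fact
  interpret Q: prob_space Q by fact
  have X_ne: "X \<noteq> {}"
    using X(1) \<mu>.AE_False by auto
  define c where "c = (SUP x\<in>X. \<phi> x - f x)"
  have lower: "\<phi> x - f x \<le> c" if "x \<in> X" for x
  proof -
    have "bdd_above ((\<lambda>x. \<phi> x - f x) ` X)"
      using osc that by (intro bdd_aboveI[of _ "\<phi> x + f x"]) (force simp: algebra_simps)
    then show ?thesis
      unfolding c_def using that by (rule cSUP_upper[rotated])
  qed
  have upper: "c \<le> \<phi> x + f x" if "x \<in> X" for x
    unfolding c_def using X_ne osc that by (intro cSUP_least) (force simp: algebra_simps)+
  have f_meas: "f \<in> borel_measurable \<mu>" using f(1) by auto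
  have [simp]: "measurable \<nu> N = measurable \<mu> N" "measurable Q N = measurable \<mu> N" for N :: "real measure"
    using sets by (auto intro: measurable_cong_sets)
  have [simp]: "measurable \<nu> N = measurable \<mu> N" "measurable Q N = measurable \<mu> N" for N :: "ennreal measure"
    using sets by (auto intro: measurable_cong_sets)
  have \<phi>_int: "integrable \<mu> \<phi>" "integrable \<nu> \<phi>"
    using \<phi> by (auto intro!: \<mu>.integrable_const_bound[of _ b] \<nu>.integrable_const_bound[of _ b])
  have 1: "ennreal e * (\<integral>\<^sup>+ x. ennreal (f x - \<phi> x + c) \<partial>Q) \<le> ennreal ((\<integral> x. f x \<partial>\<mu>) - (\<integral> x. \<phi> x \<partial>\<mu>) + c)"
  proof -
    have "ennreal e * (\<integral>\<^sup>+ x. ennreal (f x - \<phi> x + c) \<partial>Q) \<le> (\<integral>\<^sup>+ x. ennreal (f x - \<phi> x + c) \<partial>\<mu>)"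
      using f_meas \<phi>(1) by (intro nn_integral_minorized sets min(1)) auto
    also have "\<dots> = ennreal (\<integral> x. f x - \<phi> x + c \<partial>\<mu>)"
      using X(1) lower f \<phi>_int by (intro nn_integral_eq_integral) (auto elim!: eventually_mono simp: algebra_simps)
    finally show ?thesis using f \<phi>_int by (simp add: \<mu>.prob_space)
  qed
  have 2: "ennreal e * (\<integral>\<^sup>+ x. ennreal (f x + \<phi> x - c) \<partial>Q) \<le> ennreal ((\<integral> x. f x \<partial>\<nu>) + (\<integral> x. \<phi> x \<partial>\<nu>) - c)"
  proof -
    have "ennreal e * (\<integral>\<^sup>+ x. ennreal (f x + \<phi> x - c) \<partial>Q) \<le> (\<integral>\<^sup>+ x. ennreal (f x + \<phi> x - c) \<partial>\<nu>)"
      using f_meas \<phi>(1) min(2) sets by (intro nn_integral_minorized) auto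
    also have "\<dots> = ennreal (\<integral> x. f x + \<phi> x - c \<partial>\<nu>)"
      using X(2) upper f \<phi>_int by (intro nn_integral_eq_integral) (auto elim!: eventually_mono simp: algebra_simps)
    finally show ?thesis using f \<phi>_int by (simp add: \<nu>.prob_space)
  qed
  have nonneg: "0 \<le> (\<integral> x. f x \<partial>\<mu>) - (\<integral> x. \<phi> x \<partial>\<mu>) + c" "0 \<le> (\<integral> x. f x \<partial>\<nu>) + (\<integral> x. \<phi> x \<partial>\<nu>) - c"
  proof -
    have "0 \<le> (\<integral> x. f x - \<phi> x + c \<partial>\<mu>)"
      using X(1) lower by (intro integral_nonneg_AE) (auto elim!: eventually_mono simp: algebra_simps)
    then show "0 \<le> (\<integral> x. f x \<partial>\<mu>) - (\<integral> x. \<phi> x \<partial>\<mu>) + c" using f \<phi>_int by (simp add: \<mu>.prob_space)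
    have "0 \<le> (\<integral> x. f x + \<phi> x - c \<partial>\<nu>)"
      using X(2) upper by (intro integral_nonneg_AE) (auto elim!: eventually_mono simp: algebra_simps)
    then show "0 \<le> (\<integral> x. f x \<partial>\<nu>) + (\<integral> x. \<phi> x \<partial>\<nu>) - c" using f \<phi>_int by (simp add: \<nu>.prob_space)
  qed
  have "ennreal (2 * e * a) = ennreal e * (\<integral>\<^sup>+ x. ennreal (2 * a) \<partial>Q)"
    using e a by (simp add: Q.emeasure_space_1 ennreal_mult[symmetric] ac_simps)
  also have "\<dots> \<le> ennreal e * (\<integral>\<^sup>+ x. ennreal (f x - \<phi> x + c) + ennreal (f x + \<phi> x - c) \<partial>Q)"
  proof (intro mult_left_mono nn_integral_mono)
    fix x
    have "2 * a \<le> max 0 (f x - \<phi> x + c) + max 0 (f x + \<phi> x - c)" using a(2)[of x] by linarith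
    then have "ennreal (2 * a) \<le> ennreal (max 0 (f x - \<phi> x + c) + max 0 (f x + \<phi> x - c))"
      by (rule ennreal_leI)
    also have "\<dots> = ennreal (f x - \<phi> x + c) + ennreal (f x + \<phi> x - c)"
      by (subst ennreal_plus) (auto simp: ennreal_max_0)
    finally show "ennreal (2 * a) \<le> \<dots>" .
  qed simp
  also have "\<dots> = ennreal e * (\<integral>\<^sup>+ x. ennreal (f x - \<phi> x + c) \<partial>Q) + ennreal e * (\<integral>\<^sup>+ x. ennreal (f x + \<phi> x - c) \<partial>Q)"
    using f_meas \<phi>(1) by (subst nn_integral_add) (auto simp: distrib_left)
  also have "\<dots> \<le> ennreal ((\<integral> x. f x \<partial>\<mu>) - (\<integral> x. \<phi> x \<partial>\<mu>) + c) + ennreal ((\<integral> x. f x \<partial>\<nu>) + (\<integral> x. \<phi> x \<partial>\<nu>) - c)"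
    using 1 2 by (rule add_mono)
  also have "\<dots> = ennreal ((\<integral> x. f x \<partial>\<mu>) + (\<integral> x. f x \<partial>\<nu>) - ((\<integral> x. \<phi> x \<partial>\<mu>) - (\<integral> x. \<phi> x \<partial>\<nu>)))"
    using nonneg by (subst ennreal_plus[symmetric]) (auto simp: algebra_simps)
  finally show ?thesis
    using nonneg by (subst (asm) ennreal_le_iff) auto
qed

text \<open>
  The weighted oscillation of a test function shrinks by the factor \<open>\<rho>\<close> under one application of \<open>K\<close>.
  If \<open>W x + W y\<close> is large, the drift alone does this.  Otherwise both points lie in the small set,
  where \<open>integral_difference_le\<close> gains \<open>2 e\<close>; the weight \<open>\<beta>\<close> is chosen so small that the drift
  constant \<open>b\<close> costs at most half of this gain.
\<close>
lemma harris_contraction: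
  fixes K :: "'a::topological_space \<Rightarrow> 'a measure" and W :: "'a \<Rightarrow> real"
  assumes K: "K \<in> borel \<rightarrow>\<^sub>M prob_algebra borel"
    and W: "W \<in> borel_measurable borel" "\<And>x. 0 \<le> W x"
    and X: "\<And>x. x \<in> X \<Longrightarrow> AE y in K x. y \<in> X"
    and int: "\<And>x. x \<in> X \<Longrightarrow> integrable (K x) W"
    and drift: "\<And>x. x \<in> X \<Longrightarrow> (\<integral> y. W y \<partial>K x) \<le> g * W x + b"
    and g: "0 \<le> g" "g < 1" and b: "0 \<le> b"
    and Q: "prob_space Q" "sets Q = sets borel"
    and e: "0 < e" "e \<le> 1"
    and min: "\<And>x S. x \<in> X \<Longrightarrow> W x \<le> 4 * b / (1 - g) + 1 \<Longrightarrow> S \<in> sets borel \<Longrightarrow>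
                ennreal e * emeasure Q S \<le> emeasure (K x) S"
  obtains \<beta> \<rho> :: real where "0 < \<beta>" "0 < \<rho>" "\<rho> < 1"
    "\<And>\<phi> A c x y. \<phi> \<in> borel_measurable borel \<Longrightarrow> (\<And>x. \<bar>\<phi> x\<bar> \<le> c) \<Longrightarrow> 0 \<le> A \<Longrightarrow>
       (\<And>x y. x \<in> X \<Longrightarrow> y \<in> X \<Longrightarrow> \<bar>\<phi> x - \<phi> y\<bar> \<le> A * (2 + \<beta> * W x + \<beta> * W y)) \<Longrightarrow>
       x \<in> X \<Longrightarrow> y \<in> X \<Longrightarrow>
       \<bar>(\<integral> z. \<phi> z \<partial>K x) - (\<integral> z. \<phi> z \<partial>K y)\<bar> \<le> \<rho> * A * (2 + \<beta> * W x + \<beta> * W y)"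
proof -
  (* Above height R the drift removes (1 - g) s >= 4 b, twice the amount 2 b that it may add for a pair. *)
  define R where "R = 4 * b / (1 - g) + 1"
  define \<beta> where "\<beta> = e / (2 * b + 1)"
  define \<rho> where "\<rho> = max g (max (1 - e / 2) (1 - \<beta> * R * (1 - g) / (2 * (2 + \<beta> * R))))"
  have R: "0 < R" using g b by (auto simp: R_def intro!: add_nonneg_pos)
  have \<beta>: "0 < \<beta>" using e b by (auto simp: \<beta>_def)
  have \<rho>: "0 < \<rho>" "\<rho> < 1"
    using e g \<beta> R by (auto simp: \<rho>_def less_max_iff_disj intro!: divide_pos_pos mult_pos_pos add_pos_pos)
  have sum: "2 + \<beta> * (g * s + 2 * b) \<le> \<rho> * (2 + \<beta> * s)" if "R \<le> s" for s
  proof -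
    have s: "0 < s" using R that by simp
    have "4 * b / (1 - g) \<le> s" using that by (simp add: R_def)
    then have "4 * b \<le> (1 - g) * s" using g by (simp add: field_simps)
    then have 1: "2 + \<beta> * (g * s + 2 * b) \<le> 2 + \<beta> * ((1 + g) / 2 * s)"
      using \<beta> by (intro add_left_mono mult_left_mono) (auto simp: field_simps)
    define d where "d = \<beta> * R * (1 - g) / (2 * (2 + \<beta> * R))"
    have "d * (2 + \<beta> * s) \<le> \<beta> * (1 - g) / 2 * s"
    proof -
      have "R * (2 + \<beta> * s) \<le> s * (2 + \<beta> * R)" using that by (simp add: algebra_simps)
      then have "R * (2 + \<beta> * s) / (2 + \<beta> * R) \<le> s"
        using R \<beta> by (subst divide_le_eq) (auto simp: add_pos_pos)
      then have "\<beta> * (1 - g) / 2 * (R * (2 + \<beta> * s) / (2 + \<beta> * R)) \<le> \<beta> * (1 - g) / 2 * s"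
        using g \<beta> by (intro mult_left_mono) auto
      then show ?thesis by (simp add: d_def ac_simps)
    qed
    moreover have "(1 - d) * (2 + \<beta> * s) \<le> \<rho> * (2 + \<beta> * s)"
      using s \<beta> by (intro mult_right_mono) (auto simp: \<rho>_def d_def)
    ultimately show ?thesis using 1 by (simp add: algebra_simps add_divide_distrib diff_divide_distrib)
  qed
  have sum': "2 + \<beta> * (g * s + 2 * b) - 2 * e \<le> \<rho> * (2 + \<beta> * s)" if "0 \<le> s" for s
  proof -
    have "\<beta> * (2 * b) \<le> e" using e b by (simp add: \<beta>_def field_simps)
    moreover have "1 - e / 2 \<le> \<rho>" by (simp add: \<rho>_def)
    moreover have "g * (\<beta> * s) \<le> \<rho> * (\<beta> * s)"
      using that \<beta> by (intro mult_right_mono) (auto simp: \<rho>_def)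
    ultimately show ?thesis by (simp add: algebra_simps)
  qed
  have main: "(\<integral> z. \<phi> z \<partial>K x) - (\<integral> z. \<phi> z \<partial>K y) \<le> \<rho> * A * (2 + \<beta> * W x + \<beta> * W y)"
    if \<phi>: "\<phi> \<in> borel_measurable borel" "\<And>x. \<bar>\<phi> x\<bar> \<le> c" and A: "0 \<le> A"
      and osc: "\<And>x y. x \<in> X \<Longrightarrow> y \<in> X \<Longrightarrow> \<bar>\<phi> x - \<phi> y\<bar> \<le> A * (2 + \<beta> * W x + \<beta> * W y)"
      and xy: "x \<in> X" "y \<in> X" for \<phi> A c x y
  proof -
    define d where "d = (if W x \<le> R \<and> W y \<le> R then e else 0)"
    let ?f = "\<lambda>z. A * (1 + \<beta> * W z)"
    interpret x: prob_space "K x" by (rule kernel_prob_space[OF K])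
    interpret y: prob_space "K y" by (rule kernel_prob_space[OF K])
    note [simp] = kernel_prob_space(2)[OF K]
    have [measurable_cong]: "sets (K z) = sets borel" for z by simp
    have "(\<integral> z. \<phi> z \<partial>K x) - (\<integral> z. \<phi> z \<partial>K y)
        \<le> (\<integral> z. ?f z \<partial>K x) + (\<integral> z. ?f z \<partial>K y) - 2 * d * A"
    proof (rule integral_difference_le[where X=X and Q=Q and b=c])
      show "\<phi> \<in> borel_measurable (K x)" using \<phi>(1) by measurable
      show "\<phi> u - \<phi> v \<le> ?f u + ?f v" if "u \<in> X" "v \<in> X" for u v
        using osc[OF that] by (simp add: algebra_simps abs_le_iff)
      show "A \<le> ?f z" for z using A \<beta> W(2)[of z] by (simp add: algebra_simps)
      show "0 \<le> d" using e by (simp add: d_def)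
      show "ennreal d * emeasure Q S \<le> emeasure (K x) S" if "S \<in> sets (K x)" for S
        using min xy that by (simp add: d_def R_def)
      show "ennreal d * emeasure Q S \<le> emeasure (K y) S" if "S \<in> sets (K x)" for S
        using min xy that by (simp add: d_def R_def)
    qed (use int X xy \<phi> A Q in \<open>auto intro: x.prob_space_axioms y.prob_space_axioms\<close>)
    also have "\<dots> = A * (2 + \<beta> * ((\<integral> z. W z \<partial>K x) + (\<integral> z. W z \<partial>K y)) - 2 * d)"
      using int[OF xy(1)] int[OF xy(2)] x.prob_space y.prob_space by (simp add: algebra_simps)
    also have "\<dots> \<le> A * (2 + \<beta> * (g * (W x + W y) + 2 * b) - 2 * d)"
      using drift[OF xy(1)] drift[OF xy(2)] A \<beta>
      by (intro mult_left_mono diff_right_mono add_left_mono) (auto simp: algebra_simps)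
    also have "\<dots> \<le> A * (\<rho> * (2 + \<beta> * (W x + W y)))"
    proof (rule mult_left_mono[OF _ A])
      show "2 + \<beta> * (g * (W x + W y) + 2 * b) - 2 * d \<le> \<rho> * (2 + \<beta> * (W x + W y))"
        using sum[of "W x + W y"] sum'[of "W x + W y"] W(2)[of x] W(2)[of y] unfolding d_def by auto
    qed
    finally show ?thesis by (simp add: algebra_simps)
  qed
  show ?thesis
  proof (rule that[OF \<beta> \<rho>])
    fix \<phi> :: "'a \<Rightarrow> real" and A c x y
    assume \<phi>: "\<phi> \<in> borel_measurable borel" "\<And>x. \<bar>\<phi> x\<bar> \<le> c" and A: "0 \<le> A"
      and osc: "\<And>x y. x \<in> X \<Longrightarrow> y \<in> X \<Longrightarrow> \<bar>\<phi> x - \<phi> y\<bar> \<le> A * (2 + \<beta> * W x + \<beta> * W y)"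
      and xy: "x \<in> X" "y \<in> X"
    show "\<bar>(\<integral> z. \<phi> z \<partial>K x) - (\<integral> z. \<phi> z \<partial>K y)\<bar> \<le> \<rho> * A * (2 + \<beta> * W x + \<beta> * W y)"
      using main[OF \<phi> A osc xy] main[OF \<phi> A osc xy(2) xy(1)] by (simp add: abs_le_iff algebra_simps)
  qed
qed

lemma kernel_power_drift:
  fixes P :: "'a::topological_space \<Rightarrow> 'a measure" and V :: "'a \<Rightarrow> ennreal"
  assumes P: "P \<in> borel \<rightarrow>\<^sub>M prob_algebra borel" and V: "V \<in> borel_measurable borel"
    and drift: "\<And>x. (\<integral>\<^sup>+ y. V y \<partial>P x) \<le> ennreal g * V x + ennreal b"
    and g: "0 \<le> g" "g < 1" and b: "0 \<le> b"
  shows "(\<integral>\<^sup>+ y. V y \<partial>kernel_power P n x) \<le> ennreal (g ^ n) * V x + ennreal (b / (1 - g))"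
proof (induction n)
  case 0
  then show ?case using V by (simp add: nn_integral_return)
next
  case (Suc n)
  note [simp] = kernel_prob_space[OF kernel_power_measurable[OF P]]
  have [measurable_cong]: "sets (kernel_power P n x) = sets borel" by simp
  interpret n: prob_space "kernel_power P n x" by simp
  have "(\<integral>\<^sup>+ y. V y \<partial>kernel_power P (Suc n) x) = (\<integral>\<^sup>+ y. (\<integral>\<^sup>+ z. V z \<partial>P y) \<partial>kernel_power P n x)"
    using nn_integral_bind_kernel[OF P _ V] by simp
  also have "\<dots> \<le> (\<integral>\<^sup>+ y. ennreal g * V y + ennreal b \<partial>kernel_power P n x)"
    by (intro nn_integral_mono drift)
  also have "\<dots> = ennreal g * (\<integral>\<^sup>+ y. V y \<partial>kernel_power P n x) + ennreal b"
    using V n.emeasure_space_1 by (simp add: nn_integral_add nn_integral_cmult)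
  also have "\<dots> \<le> ennreal g * (ennreal (g ^ n) * V x + ennreal (b / (1 - g))) + ennreal b"
    by (intro add_mono mult_left_mono Suc) simp_all
  also have "\<dots> = ennreal (g ^ Suc n) * V x + (ennreal (g * (b / (1 - g))) + ennreal b)"
    using g b by (simp add: distrib_left ennreal_mult mult.assoc add.assoc del: times_divide_eq_right)
  also have "ennreal (g * (b / (1 - g))) + ennreal b = ennreal (b / (1 - g))"
    using g b by (subst ennreal_plus[symmetric]) (auto simp: field_simps)
  finally show ?case .
qed

lemma invariant_kernel_power:
  fixes P :: "'a::topological_space \<Rightarrow> 'a measure"
  assumes P: "P \<in> borel \<rightarrow>\<^sub>M prob_algebra borel" and \<mu>: "sets \<mu> = sets borel" "bind \<mu> P = \<mu>"
  shows "bind \<mu> (kernel_power P n) = \<mu>"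
proof (induction n)
  case 0
  have "kernel_power P 0 = return borel" by (simp add: fun_eq_iff)
  then show ?case using \<mu> by (simp add: bind_return'')
next
  case (Suc n)
  have "kernel_power P (Suc n) = (\<lambda>x. bind (kernel_power P n x) P)" by (simp add: fun_eq_iff)
  moreover have "bind (bind \<mu> (kernel_power P n)) P = bind \<mu> (\<lambda>x. bind (kernel_power P n x) P)"
    using measurable_prob_algebraD[OF kernel_power_measurable[OF P, of n]] measurable_prob_algebraD[OF P] \<mu>(1)
    by (intro bind_assoc[where N=borel and R=borel]) (simp_all cong: measurable_cong_sets)
  ultimately show ?case using Suc \<mu> by simp
qed

lemma integrable_enn2real:
  assumes f: "f \<in> borel_measurable M" and fin: "(\<integral>\<^sup>+ x. f x \<partial>M) < \<infinity>"
  shows "integrable M (\<lambda>x. enn2real (f x))" "AE x in M. f x < \<infinity>"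
    "(\<integral> x. enn2real (f x) \<partial>M) = enn2real (\<integral>\<^sup>+ x. f x \<partial>M)"
proof -
  show ae: "AE x in M. f x < \<infinity>"
    using nn_integral_PInf_AE[OF f] fin by (auto simp: less_top)
  have eq: "(\<integral>\<^sup>+ x. ennreal (enn2real (f x)) \<partial>M) = (\<integral>\<^sup>+ x. f x \<partial>M)"
    using ae by (intro nn_integral_cong_AE) (auto elim!: eventually_mono)
  show "integrable M (\<lambda>x. enn2real (f x))"
    using f fin eq by (intro integrableI_nonneg) auto
  show "(\<integral> x. enn2real (f x) \<partial>M) = enn2real (\<integral>\<^sup>+ x. f x \<partial>M)"
    using f eq by (simp add: integral_eq_nn_integral)
qed

text \<open>
  The contraction is applied to the \<open>m\<close>-step kernel, with \<open>m\<close> coming from the minorization on the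
  sublevel set that \<open>harris_contraction\<close> asks for.  The drift bound for \<open>m\<close> steps has the constant
  \<open>b / (1 - g)\<close> for every \<open>m\<close>, so this height can be fixed before \<open>m\<close> is known.  Indicator
  functions have oscillation at most 1, hence after \<open>n\<close> steps the probabilities of a set from \<open>x\<close>
  and \<open>y\<close> differ by at most \<open>\<rho> ^ (n div m)\<close> times the weight; averaging \<open>y\<close> over the invariant
  distribution gives the claim.  Points with \<open>V x = \<infinity>\<close> are null and receive \<open>M x = \<infinity>\<close>.
\<close>
theorem geometrically_ergodic_if_drift:
  fixes P :: "'a::topological_space \<Rightarrow> 'a measure" and V :: "'a \<Rightarrow> ennreal"
  assumes P: "P \<in> borel \<rightarrow>\<^sub>M prob_algebra borel" and V: "V \<in> borel_measurable borel"
    and drift: "\<And>x. (\<integral>\<^sup>+ y. V y \<partial>P x) \<le> ennreal g * V x + ennreal b"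
    and g: "0 \<le> g" "g < 1" and b: "0 \<le> b"
    and small: "\<And>R. \<exists>m e Q. 0 < m \<and> 0 < e \<and> prob_space Q \<and> sets Q = sets borel \<and>
       (\<forall>x. V x \<le> ennreal R \<longrightarrow> (\<forall>S\<in>sets borel.
          ennreal e * emeasure Q S \<le> emeasure (kernel_power P m x) S))"
    and \<mu>: "prob_space \<mu>" "sets \<mu> = sets borel" "bind \<mu> P = \<mu>"
    and fin: "(\<integral>\<^sup>+ x. V x \<partial>\<mu>) < \<infinity>"
  shows "geometrically_ergodic P \<mu>"
proof -
  define b' where "b' = b / (1 - g)"
  have b': "0 \<le> b'" using g b by (simp add: b'_def)
  obtain m e Q where m: "0 < m" and e: "0 < e" and Q: "prob_space Q" "sets Q = sets borel"
    and min: "\<And>x S. V x \<le> ennreal (4 * b' / (1 - g) + 1) \<Longrightarrow> S \<in> sets borel \<Longrightarrow>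
                ennreal e * emeasure Q S \<le> emeasure (kernel_power P m x) S"
    using small[of "4 * b' / (1 - g) + 1"] by blast
  define K where "K = kernel_power P m"
  define X where "X = {x. V x < \<infinity>}"
  define W where "W x = enn2real (V x)" for x
  note kp = kernel_prob_space[OF kernel_power_measurable[OF P]]
  have K: "K \<in> borel \<rightarrow>\<^sub>M prob_algebra borel" unfolding K_def by (rule kernel_power_measurable[OF P])
  have W_meas: "W \<in> borel_measurable borel" unfolding W_def using V by measurable
  have VK: "(\<integral>\<^sup>+ y. V y \<partial>K x) \<le> ennreal (g * W x + b')" if "x \<in> X" for x
  proof -
    have "(\<integral>\<^sup>+ y. V y \<partial>K x) \<le> ennreal (g ^ m) * V x + ennreal b'"
      unfolding K_def b'_def by (rule kernel_power_drift[OF P V drift g b])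
    also have "\<dots> \<le> ennreal g * V x + ennreal b'"
      using g m power_decreasing[of 1 m g] by (intro add_mono mult_right_mono ennreal_leI) auto
    also have "\<dots> = ennreal (g * W x + b')"
      using that g b' by (simp add: X_def W_def ennreal_plus ennreal_mult)
    finally show ?thesis .
  qed
  have V_K: "V \<in> borel_measurable (K x)" for x
    using V by (simp add: K_def kp cong: measurable_cong_sets)
  have VK_fin: "(\<integral>\<^sup>+ y. V y \<partial>K x) < \<infinity>" if "x \<in> X" for x
    using VK[OF that] by (auto simp: less_top intro: order.strict_trans1)
  obtain \<beta> \<rho> where \<beta>: "0 < \<beta>" and \<rho>: "0 < \<rho>" "\<rho> < 1" and
    contr: "\<And>\<phi> A c x y. \<phi> \<in> borel_measurable borel \<Longrightarrow> (\<And>x. \<bar>\<phi> x\<bar> \<le> c) \<Longrightarrow> 0 \<le> A \<Longrightarrow>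
       (\<And>x y. x \<in> X \<Longrightarrow> y \<in> X \<Longrightarrow> \<bar>\<phi> x - \<phi> y\<bar> \<le> A * (2 + \<beta> * W x + \<beta> * W y)) \<Longrightarrow>
       x \<in> X \<Longrightarrow> y \<in> X \<Longrightarrow>
       \<bar>(\<integral> z. \<phi> z \<partial>K x) - (\<integral> z. \<phi> z \<partial>K y)\<bar> \<le> \<rho> * A * (2 + \<beta> * W x + \<beta> * W y)"
  proof (rule harris_contraction[OF K W_meas _ _ _ _ g b' Q, of X "min e 1"])
    show "AE y in K x. y \<in> X" if "x \<in> X" for x
      using integrable_enn2real(2)[OF V_K VK_fin[OF that]] by (simp add: X_def)
    show "integrable (K x) W" if "x \<in> X" for x
      using integrable_enn2real(1)[OF V_K VK_fin[OF that]] by (simp add: W_def[abs_def])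
    show "(\<integral> y. W y \<partial>K x) \<le> g * W x + b'" if "x \<in> X" for x
    proof -
      have "(\<integral> y. W y \<partial>K x) = enn2real (\<integral>\<^sup>+ y. V y \<partial>K x)"
        unfolding W_def by (rule integrable_enn2real(3)[OF V_K VK_fin[OF that]])
      also have "\<dots> \<le> g * W x + b'"
        using VK[OF that] g b' by (intro enn2real_leI) (auto simp: W_def)
      finally show ?thesis .
    qed
    show "ennreal (min e 1) * emeasure Q S \<le> emeasure (K x) S"
      if "x \<in> X" "W x \<le> 4 * b' / (1 - g) + 1" "S \<in> sets borel" for x S
    proof -
      have "V x = ennreal (W x)" using that(1) by (simp add: X_def W_def)
      then have "V x \<le> ennreal (4 * b' / (1 - g) + 1)" using that(2) by (simp add: ennreal_leI)
      from min[OF this that(3)] show ?thesis unfolding K_def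
        by (rule order_trans[rotated]) (auto intro!: mult_right_mono ennreal_leI)
    qed
  qed (use e in \<open>auto simp: W_def\<close>)
  have meas: "(\<lambda>x. measure (kernel_power P n x) S) \<in> borel_measurable borel" if "S \<in> sets borel" for n S
    using measurable_compose[OF measurable_prob_algebraD[OF kernel_power_measurable[OF P]]
        measurable_measure_subprob_algebra[OF that]] .
  have le1: "measure (kernel_power P n x) S \<le> 1" for n x S
    using prob_space.prob_le_1[OF kp(1)] .
  (* The remainder r is absorbed into the test function, so only blocks of m steps contract. *)
  have osc: "\<bar>measure (kernel_power P (m * q + r) x) S - measure (kernel_power P (m * q + r) y) S\<bar>
      \<le> \<rho> ^ q * (2 + \<beta> * W x + \<beta> * W y)"
    if S: "S \<in> sets borel" and "x \<in> X" "y \<in> X" for q r S x y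
    using that(2,3)
  proof (induction q arbitrary: x y)
    case 0
    have "\<bar>measure (kernel_power P r x) S - measure (kernel_power P r y) S\<bar> \<le> 1"
      using le1[of r x S] le1[of r y S] measure_nonneg[of "kernel_power P r x" S]
        measure_nonneg[of "kernel_power P r y" S] by linarith
    also have "1 \<le> 2 + \<beta> * W x + \<beta> * W y" using \<beta> by (simp add: W_def)
    finally show ?case by simp
  next
    case (Suc q)
    let ?\<phi> = "\<lambda>x. measure (kernel_power P (m * q + r) x) S"
    have eq: "measure (kernel_power P (m * Suc q + r) z) S = (\<integral> u. ?\<phi> u \<partial>K z)" for z
    proof -
      interpret z: prob_space "K z" by (simp add: K_def kp)
      have "kernel_power P (m * Suc q + r) z = bind (K z) (kernel_power P (m * q + r))"
        using kernel_power_add[OF P, of m "m * q + r" z] by (simp add: K_def add.assoc)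
      then show ?thesis
        using z.measure_bind[of "kernel_power P (m * q + r)" borel S] S
          measurable_prob_algebraD[OF kernel_power_measurable[OF P, of "m * q + r"]]
        by (simp add: K_def kp cong: measurable_cong_sets)
    qed
    have "\<bar>(\<integral> u. ?\<phi> u \<partial>K x) - (\<integral> u. ?\<phi> u \<partial>K y)\<bar> \<le> \<rho> * \<rho> ^ q * (2 + \<beta> * W x + \<beta> * W y)"
      using \<rho> le1 meas[OF S] Suc by (intro contr[where c=1]) auto
    then show ?case by (simp only: eq power_Suc)
  qed
  define \<sigma> where "\<sigma> = root m \<rho>"
  have \<sigma>: "0 < \<sigma>" "\<sigma> < 1" "\<sigma> ^ m = \<rho>" using m \<rho> by (auto simp: \<sigma>_def)
  have pow: "\<rho> ^ (n div m) \<le> \<sigma> ^ n / \<rho>" for n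
  proof -
    have "\<rho> ^ (n div m) * \<rho> \<le> \<rho> ^ (n div m) * \<sigma> ^ (n mod m)"
      using \<sigma> \<rho> m power_decreasing[of "n mod m" m \<sigma>] by (intro mult_left_mono) auto
    also have "\<dots> = \<sigma> ^ (m * (n div m) + n mod m)" by (simp only: power_add power_mult \<sigma>(3))
    finally show ?thesis using \<rho> by (simp add: field_simps)
  qed
  interpret \<mu>: prob_space \<mu> by fact
  have \<mu>V: "V \<in> borel_measurable \<mu>" using V \<mu>(2) by (simp cong: measurable_cong_sets)
  have W_int: "integrable \<mu> W" and X_AE: "AE x in \<mu>. x \<in> X"
    using integrable_enn2real[OF \<mu>V fin] by (simp_all add: W_def[abs_def] X_def)
  define w where "w = (\<integral> x. W x \<partial>\<mu>)"
  have w: "0 \<le> w" unfolding w_def by (rule integral_nonneg_AE) (simp add: W_def)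
  have conv: "\<bar>measure (kernel_power P n x) S - measure \<mu> S\<bar> \<le> (2 + \<beta> * W x + \<beta> * w) / \<rho> * \<sigma> ^ n"
    if x: "x \<in> X" and S: "S \<in> sets borel" for n x S
  proof -
    let ?\<phi> = "\<lambda>x. measure (kernel_power P n x) S"
    have \<phi>_int: "integrable \<mu> ?\<phi>"
      using le1 meas[OF S] \<mu>(2) by (intro \<mu>.integrable_const_bound[of _ 1]) (auto cong: measurable_cong_sets)
    have "measure \<mu> S = (\<integral> y. ?\<phi> y \<partial>\<mu>)"
      using \<mu>.measure_bind[of "kernel_power P n" borel S] S \<mu>(2)
        measurable_prob_algebraD[OF kernel_power_measurable[OF P, of n]]
      by (simp add: invariant_kernel_power[OF P \<mu>(2,3)] cong: measurable_cong_sets)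
    then have "?\<phi> x - measure \<mu> S = (\<integral> y. ?\<phi> x - ?\<phi> y \<partial>\<mu>)"
      using \<phi>_int by (simp add: \<mu>.prob_space)
    also have "\<bar>\<dots>\<bar> \<le> (\<integral> y. \<bar>?\<phi> x - ?\<phi> y\<bar> \<partial>\<mu>)" by (rule integral_abs_bound)
    also have "\<dots> \<le> (\<integral> y. \<rho> ^ (n div m) * (2 + \<beta> * W x + \<beta> * W y) \<partial>\<mu>)"
    proof (rule integral_mono_AE)
      show "AE y in \<mu>. \<bar>?\<phi> x - ?\<phi> y\<bar> \<le> \<rho> ^ (n div m) * (2 + \<beta> * W x + \<beta> * W y)"
        using X_AE by eventually_elim (use osc[OF S x, of _ "n div m" "n mod m"] in simp)
    qed (use \<phi>_int W_int in auto)
    also have "\<dots> = \<rho> ^ (n div m) * (2 + \<beta> * W x + \<beta> * w)"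
      using W_int by (simp add: w_def \<mu>.prob_space)
    also have "\<dots> \<le> \<sigma> ^ n / \<rho> * (2 + \<beta> * W x + \<beta> * w)"
      using \<beta> w by (intro mult_right_mono pow) (auto simp: W_def)
    finally show ?thesis by (simp add: ac_simps)
  qed
  define M where "M x = (if V x < \<infinity> then ennreal ((2 + \<beta> * W x + \<beta> * w) / \<rho>) else \<infinity>)" for x
  show ?thesis
    unfolding geometrically_ergodic_def
  proof (intro exI[of _ \<sigma>] exI[of _ M] conjI allI)
    show "AE x in \<mu>. M x < \<infinity>" using X_AE by (auto simp: M_def X_def elim!: eventually_mono)
    show "ennreal (tv_distance (kernel_power P n x) \<mu>) \<le> M x * ennreal (\<sigma> ^ n)" for n x
    proof (cases "x \<in> X")
      case True
      have "tv_distance (kernel_power P n x) \<mu> \<le> (2 + \<beta> * W x + \<beta> * w) / \<rho> * \<sigma> ^ n"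
        unfolding tv_distance_def using conv[OF True] by (intro cSUP_least) auto
      then have "ennreal (tv_distance (kernel_power P n x) \<mu>) \<le> ennreal ((2 + \<beta> * W x + \<beta> * w) / \<rho> * \<sigma> ^ n)"
        by (rule ennreal_leI)
      also have "\<dots> = M x * ennreal (\<sigma> ^ n)"
        using True \<beta> \<rho> \<sigma> w by (subst ennreal_mult) (auto simp: M_def X_def W_def)
      finally show ?thesis .
    next
      case False
      then show ?thesis using \<sigma> by (simp add: M_def X_def ennreal_top_mult)
    qed
  qed (use \<sigma> in auto)
qed

section \<open>Metropolis-Hastings kernels\<close>

lemma mh_accept_bounds:
  assumes "\<And>x. 0 \<le> p x" "\<And>x y. 0 \<le> q x y"
  shows "0 \<le> mh_accept p q x y" "mh_accept p q x y \<le> 1"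
  using assms by (auto simp: mh_accept_def)

lemma mh_accept_measurable:
  fixes p :: "'a::euclidean_space \<Rightarrow> real"
  assumes [measurable]: "p \<in> borel_measurable borel"
    "(\<lambda>(x, y). q x y) \<in> borel_measurable (borel \<Otimes>\<^sub>M borel)"
  shows "(\<lambda>(x, y). mh_accept p q x y) \<in> borel_measurable (borel \<Otimes>\<^sub>M borel)"
  unfolding mh_accept_def by measurable

text \<open>The left-hand side is the stationary flow from \<open>x\<close> to \<open>y\<close>; the right-hand side is symmetric, which
  is detailed balance.  Both sides vanish if \<open>p x * q x y = 0\<close>, where the quotient in \<open>mh_accept\<close> is 0
  by convention.\<close>
lemma mh_accept_flow:
  assumes "\<And>x. 0 \<le> p x" "\<And>x y. 0 \<le> q x y"
  shows "p x * q x y * mh_accept p q x y = min (p x * q x y) (p y * q y x)"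
proof (cases "p x * q x y = 0")
  case True
  then show ?thesis using assms by (auto simp: min_def)
next
  case False
  then have "0 < p x * q x y" using assms by (simp add: less_le)
  then show ?thesis by (auto simp: mh_accept_def min_def field_simps)
qed

lemma bernoulli_choice_measurable:
  "(\<lambda>accepted. return borel (if accepted then y else x))
     \<in> measure_pmf (bernoulli_pmf a) \<rightarrow>\<^sub>M subprob_algebra (borel :: 'a::topological_space measure)"
  by (auto simp: space_subprob_algebra subprob_space_return)

lemma nn_integral_bernoulli_choice:
  fixes f :: "'a::topological_space \<Rightarrow> ennreal"
  assumes "0 \<le> a" "a \<le> 1" "f \<in> borel_measurable borel"
  shows "(\<integral>\<^sup>+ z. f z \<partial>bind (measure_pmf (bernoulli_pmf a)) (\<lambda>accepted. return borel (if accepted then y else x)))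
    = f y * ennreal a + f x * ennreal (1 - a)"
  using assms by (subst nn_integral_bind[OF _ bernoulli_choice_measurable]) (simp_all add: nn_integral_return)

lemma sets_bernoulli_choice:
  "sets (bind (measure_pmf (bernoulli_pmf a)) (\<lambda>accepted. return borel (if accepted then y else x))) =
     sets (borel :: 'a::topological_space measure)"
  by (rule sets_bind) auto

lemma mh_step_measurable:
  fixes p :: "'a::euclidean_space \<Rightarrow> real"
  assumes p: "p \<in> borel_measurable borel" "\<And>x. 0 \<le> p x"
    and q: "(\<lambda>(x, y). q x y) \<in> borel_measurable (borel \<Otimes>\<^sub>M borel)" "\<And>x y. 0 \<le> q x y"
  shows "(\<lambda>y. bind (measure_pmf (bernoulli_pmf (mh_accept p q x y)))
           (\<lambda>accepted. return borel (if accepted then y else x))) \<in> borel \<rightarrow>\<^sub>M subprob_algebra borel"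
    (is "?N \<in> _")
proof (rule measurable_subprob_algebra)
  note acc = mh_accept_bounds[of p q, OF p(2) q(2)]
  have acc_x: "(\<lambda>y. mh_accept p q x y) \<in> borel_measurable borel"
    using measurable_compose[OF measurable_Pair1' mh_accept_measurable[OF p(1) q(1)], of x] by simp
  show "sets (?N y) = sets borel" for y by (rule sets_bernoulli_choice)
  then have sp: "space (?N y) = UNIV" for y using sets_eq_imp_space_eq by fastforce
  have em: "emeasure (?N y) A = indicator A y * ennreal (mh_accept p q x y) + indicator A x * ennreal (1 - mh_accept p q x y)"
    if "A \<in> sets borel" for A y
    using nn_integral_bernoulli_choice[OF acc[of x y], of "indicator A"] that
    by (subst (asm) nn_integral_indicator) (auto simp: sets_bernoulli_choice)
  show "subprob_space (?N y)" for y
    using em[of UNIV y] acc[of x y]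
    by (intro subprob_spaceI) (auto simp: sp simp flip: ennreal_plus)
  show "(\<lambda>y. emeasure (?N y) A) \<in> borel_measurable borel" if "A \<in> sets borel" for A
    unfolding em[OF that] using acc_x that by measurable
qed

lemma nn_integral_mh_kernel:
  fixes p :: "'a::euclidean_space \<Rightarrow> real"
  assumes p: "p \<in> borel_measurable borel" "\<And>x. 0 \<le> p x"
    and q: "(\<lambda>(x, y). q x y) \<in> borel_measurable (borel \<Otimes>\<^sub>M borel)" "\<And>x y. 0 \<le> q x y"
    and f: "f \<in> borel_measurable borel"
  shows "(\<integral>\<^sup>+ z. f z \<partial>mh_kernel p q x) =
    (\<integral>\<^sup>+ y. ennreal (q x y * mh_accept p q x y) * f y + ennreal (q x y * (1 - mh_accept p q x y)) * f x \<partial>lborel)"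
proof -
  note acc = mh_accept_bounds[of p q, OF p(2) q(2)]
  have [measurable]: "(\<lambda>y. mh_accept p q x y) \<in> borel_measurable borel"
    using measurable_compose[OF measurable_Pair1' mh_accept_measurable[OF p(1) q(1)], of x] by simp
  have [measurable]: "(\<lambda>y. q x y) \<in> borel_measurable borel"
    using measurable_compose[OF measurable_Pair1' q(1), of x] by simp
  have "(\<integral>\<^sup>+ z. f z \<partial>mh_kernel p q x) =
     (\<integral>\<^sup>+ y. f y * ennreal (mh_accept p q x y) + f x * ennreal (1 - mh_accept p q x y)
        \<partial>density lborel (\<lambda>y. ennreal (q x y)))"
    unfolding mh_kernel_def using mh_step_measurable[OF p q, of x] acc f
    by (subst nn_integral_bind[where B=borel]) (simp_all add: nn_integral_bernoulli_choice)
  also have "\<dots> = (\<integral>\<^sup>+ y. ennreal (q x y) * (f y * ennreal (mh_accept p q x y)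
      + f x * ennreal (1 - mh_accept p q x y)) \<partial>lborel)"
    using f by (subst nn_integral_density) auto
  finally show ?thesis
    using acc q(2) by (simp add: ennreal_mult distrib_left ac_simps)
qed

lemma sets_mh_kernel:
  fixes p :: "'a::euclidean_space \<Rightarrow> real"
  shows "sets (mh_kernel p q x) = sets borel"
  unfolding mh_kernel_def by (rule sets_bind) (simp_all add: sets_bernoulli_choice)

lemma emeasure_mh_kernel:
  fixes p :: "'a::euclidean_space \<Rightarrow> real"
  assumes p: "p \<in> borel_measurable borel" "\<And>x. 0 \<le> p x"
    and q: "(\<lambda>(x, y). q x y) \<in> borel_measurable (borel \<Otimes>\<^sub>M borel)" "\<And>x y. 0 \<le> q x y"
    and S: "S \<in> sets borel"
  shows "emeasure (mh_kernel p q x) S =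
    (\<integral>\<^sup>+ y. ennreal (q x y * mh_accept p q x y) * indicator S y
       + ennreal (q x y * (1 - mh_accept p q x y)) * indicator S x \<partial>lborel)"
proof -
  have "emeasure (mh_kernel p q x) S = (\<integral>\<^sup>+ z. indicator S z \<partial>mh_kernel p q x)"
    using S by (simp add: sets_mh_kernel)
  also have "\<dots> = (\<integral>\<^sup>+ y. ennreal (q x y * mh_accept p q x y) * indicator S y
       + ennreal (q x y * (1 - mh_accept p q x y)) * indicator S x \<partial>lborel)"
    using S by (intro nn_integral_mh_kernel[OF p q]) simp
  finally show ?thesis .
qed

text \<open>The set \<open>N\<close> collects the points where the proposal density is degenerate and the kernel is
  replaced by an arbitrary law.\<close>
lemma mh_kernel_measurable:
  fixes p :: "'a::euclidean_space \<Rightarrow> real"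
  assumes p: "p \<in> borel_measurable borel" "\<And>x. 0 \<le> p x"
    and q: "(\<lambda>(x, y). q x y) \<in> borel_measurable (borel \<Otimes>\<^sub>M borel)" "\<And>x y. 0 \<le> q x y"
    and N: "N \<in> sets borel" "\<And>x. x \<notin> N \<Longrightarrow> (\<integral>\<^sup>+ y. ennreal (q x y) \<partial>lborel) = 1"
    and P0: "prob_space P0" "sets P0 = sets borel"
  shows "(\<lambda>x. if x \<in> N then P0 else mh_kernel p q x) \<in> borel \<rightarrow>\<^sub>M prob_algebra borel"
proof -
  note acc = mh_accept_bounds[of p q, OF p(2) q(2)]
  note em = emeasure_mh_kernel[OF p q]
  have prob: "prob_space (mh_kernel p q x)" if "x \<notin> N" for x
  proof
    have "emeasure (mh_kernel p q x) (space (mh_kernel p q x)) =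
       (\<integral>\<^sup>+ y. ennreal (q x y * mh_accept p q x y) + ennreal (q x y * (1 - mh_accept p q x y)) \<partial>lborel)"
      using em[of UNIV x] sets_eq_imp_space_eq[OF sets_mh_kernel[of p q x]] by simp
    also have "\<dots> = (\<integral>\<^sup>+ y. ennreal (q x y) \<partial>lborel)"
    proof (intro nn_integral_cong)
      fix y
      show "ennreal (q x y * mh_accept p q x y) + ennreal (q x y * (1 - mh_accept p q x y)) = ennreal (q x y)"
        using acc[of x y] q(2)[of x y] by (subst ennreal_plus[symmetric]) (auto simp: right_diff_distrib mult_left_le)
    qed
    finally show "emeasure (mh_kernel p q x) (space (mh_kernel p q x)) = 1" using N(2)[OF that] by simp
  qed
  have m1 [measurable]: "(\<lambda>(x, y). mh_accept p q x y) \<in> borel_measurable (borel \<Otimes>\<^sub>M lborel)"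
    and m2 [measurable]: "(\<lambda>(x, y). q x y) \<in> borel_measurable (borel \<Otimes>\<^sub>M lborel)"
    using mh_accept_measurable[OF p(1) q(1)] q(1) by (simp_all cong: measurable_cong_sets)
  show ?thesis
  proof (intro measurable_prob_algebraI measurable_subprob_algebra)
    fix S :: "'a set" assume S [measurable]: "S \<in> sets borel"
    have "(\<lambda>x. emeasure (mh_kernel p q x) S) \<in> borel_measurable borel"
      unfolding em[OF S] by measurable
    then have "(\<lambda>x. if x \<in> N then emeasure P0 S else emeasure (mh_kernel p q x) S) \<in> borel_measurable borel"
      using N(1) by measurable
    then show "(\<lambda>x. emeasure (if x \<in> N then P0 else mh_kernel p q x) S) \<in> borel_measurable borel"
      by (simp add: if_distrib[of "\<lambda>M. emeasure M S"])
  qed (auto simp: prob P0 sets_mh_kernel prob_space_imp_subprob_space)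
qed

text \<open>The part of the kernel that moves has the symmetric flow \<open>a\<close> with respect to \<open>p\<close>, so
  exchanging the order of integration replaces \<open>f y\<close> by \<open>f x\<close> there.  Together with the part \<open>b\<close> that
  stays put, which carries \<open>f x\<close> from the start, this adds up to the full proposal mass.\<close>
lemma nn_integral_mh_kernel_reversible:
  fixes p :: "'a::euclidean_space \<Rightarrow> real"
  assumes p: "p \<in> borel_measurable borel" "\<And>x. 0 \<le> p x"
    and q: "(\<lambda>(x, y). q x y) \<in> borel_measurable (borel \<Otimes>\<^sub>M borel)" "\<And>x y. 0 \<le> q x y"
    and one: "\<And>x. p x \<noteq> 0 \<Longrightarrow> (\<integral>\<^sup>+ y. ennreal (q x y) \<partial>lborel) = 1"
    and f [measurable]: "f \<in> borel_measurable borel"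
  shows "(\<integral>\<^sup>+ x. ennreal (p x) * (\<integral>\<^sup>+ z. f z \<partial>mh_kernel p q x) \<partial>lborel) = (\<integral>\<^sup>+ x. ennreal (p x) * f x \<partial>lborel)"
proof -
  define a where "a x y = ennreal (p x * (q x y * mh_accept p q x y))" for x y
  define b where "b x y = ennreal (p x * (q x y * (1 - mh_accept p q x y)))" for x y
  note acc = mh_accept_bounds[of p q, OF p(2) q(2)]
  have m1 [measurable]: "(\<lambda>(x, y). mh_accept p q x y) \<in> borel_measurable (lborel \<Otimes>\<^sub>M lborel)"
    and m2 [measurable]: "(\<lambda>(x, y). q x y) \<in> borel_measurable (lborel \<Otimes>\<^sub>M lborel)"
    using mh_accept_measurable[OF p(1) q(1)] q(1) by (simp_all cong: measurable_cong_sets)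
  have m3 [measurable]: "p \<in> borel_measurable lborel" using p(1) by simp
  have [measurable]: "(\<lambda>y. mh_accept p q x y) \<in> borel_measurable borel" for x
    using measurable_compose[OF measurable_Pair1' mh_accept_measurable[OF p(1) q(1)], of x] by simp
  have [measurable]: "(\<lambda>y. q x y) \<in> borel_measurable borel" for x
    using measurable_compose[OF measurable_Pair1' q(1), of x] by simp
  have [measurable]: "(\<lambda>(x, y). a x y) \<in> borel_measurable (lborel \<Otimes>\<^sub>M lborel)"
    "(\<lambda>(x, y). b x y) \<in> borel_measurable (lborel \<Otimes>\<^sub>M lborel)"
    "\<And>x. a x \<in> borel_measurable borel" "\<And>x. b x \<in> borel_measurable borel"
    unfolding a_def b_def by measurable
  have sym: "a x y = a y x" for x y
    using mh_accept_flow[of p q x y, OF p(2) q(2)] mh_accept_flow[of p q y x, OF p(2) q(2)]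
    by (simp add: a_def mult.assoc min.commute)
  have ab: "a x y + b x y = ennreal (p x) * ennreal (q x y)" for x y
  proof -
    have "a x y + b x y = ennreal (p x * (q x y * mh_accept p q x y) + p x * (q x y * (1 - mh_accept p q x y)))"
      unfolding a_def b_def using acc p(2) q(2) by (intro ennreal_plus[symmetric]) auto
    also have "\<dots> = ennreal (p x * q x y)" by (simp add: algebra_simps)
    finally show ?thesis using p(2) q(2) by (simp add: ennreal_mult)
  qed
  have "(\<integral>\<^sup>+ x. ennreal (p x) * (\<integral>\<^sup>+ z. f z \<partial>mh_kernel p q x) \<partial>lborel)
      = (\<integral>\<^sup>+ x. (\<integral>\<^sup>+ y. a x y * f y \<partial>lborel) + (\<integral>\<^sup>+ y. b x y * f x \<partial>lborel) \<partial>lborel)"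
  proof (intro nn_integral_cong)
    fix x
    have "ennreal (p x) * (\<integral>\<^sup>+ z. f z \<partial>mh_kernel p q x) = (\<integral>\<^sup>+ y. ennreal (p x) *
       (ennreal (q x y * mh_accept p q x y) * f y + ennreal (q x y * (1 - mh_accept p q x y)) * f x) \<partial>lborel)"
      unfolding nn_integral_mh_kernel[OF p q f] by (rule nn_integral_cmult[symmetric]) measurable
    also have "\<dots> = (\<integral>\<^sup>+ y. a x y * f y + b x y * f x \<partial>lborel)"
      unfolding a_def b_def using acc p(2) q(2)
      by (intro nn_integral_cong) (simp add: distrib_left ennreal_mult mult.assoc)
    also have "\<dots> = (\<integral>\<^sup>+ y. a x y * f y \<partial>lborel) + (\<integral>\<^sup>+ y. b x y * f x \<partial>lborel)"
      by (rule nn_integral_add) measurable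
    finally show "ennreal (p x) * (\<integral>\<^sup>+ z. f z \<partial>mh_kernel p q x) = \<dots>" .
  qed
  also have "\<dots> = (\<integral>\<^sup>+ x. (\<integral>\<^sup>+ y. a x y * f y \<partial>lborel) \<partial>lborel) + (\<integral>\<^sup>+ x. (\<integral>\<^sup>+ y. b x y * f x \<partial>lborel) \<partial>lborel)"
    by (rule nn_integral_add) measurable
  also have "(\<integral>\<^sup>+ x. (\<integral>\<^sup>+ y. a x y * f y \<partial>lborel) \<partial>lborel) = (\<integral>\<^sup>+ y. (\<integral>\<^sup>+ x. a x y * f y \<partial>lborel) \<partial>lborel)"
    by (rule lborel_pair.Fubini'[symmetric]) measurable
  also have "\<dots> = (\<integral>\<^sup>+ x. (\<integral>\<^sup>+ y. a x y * f x \<partial>lborel) \<partial>lborel)"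
    by (simp add: sym[of _ _])
  also have "\<dots> + (\<integral>\<^sup>+ x. (\<integral>\<^sup>+ y. b x y * f x \<partial>lborel) \<partial>lborel)
     = (\<integral>\<^sup>+ x. (\<integral>\<^sup>+ y. a x y * f x \<partial>lborel) + (\<integral>\<^sup>+ y. b x y * f x \<partial>lborel) \<partial>lborel)"
    by (rule nn_integral_add[symmetric]) measurable
  also have "\<dots> = (\<integral>\<^sup>+ x. ennreal (p x) * f x \<partial>lborel)"
  proof (intro nn_integral_cong)
    fix x
    have "(\<integral>\<^sup>+ y. a x y * f x \<partial>lborel) + (\<integral>\<^sup>+ y. b x y * f x \<partial>lborel) = (\<integral>\<^sup>+ y. (a x y + b x y) * f x \<partial>lborel)"
      by (subst nn_integral_add[symmetric]) (auto simp: distrib_right)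
    also have "\<dots> = (\<integral>\<^sup>+ y. ennreal (p x) * f x * ennreal (q x y) \<partial>lborel)"
      unfolding ab by (simp add: ac_simps)
    also have "\<dots> = ennreal (p x) * f x * (\<integral>\<^sup>+ y. ennreal (q x y) \<partial>lborel)"
      by (rule nn_integral_cmult) measurable
    finally show "(\<integral>\<^sup>+ y. a x y * f x \<partial>lborel) + (\<integral>\<^sup>+ y. b x y * f x \<partial>lborel) = ennreal (p x) * f x"
      using one[of x] by (cases "p x = 0") auto
  qed
  finally show ?thesis .
qed

lemma prob_space_normalized_density:
  fixes p :: "'a::euclidean_space \<Rightarrow> real"
  assumes [measurable]: "p \<in> borel_measurable borel"
    and Z: "(\<integral>\<^sup>+ x. ennreal (p x) \<partial>lborel) \<noteq> 0" "(\<integral>\<^sup>+ x. ennreal (p x) \<partial>lborel) < \<infinity>"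
  shows "prob_space (normalized_density p)"
proof
  have "emeasure (normalized_density p) (space (normalized_density p)) =
      (\<integral>\<^sup>+ x. ennreal (p x) / (\<integral>\<^sup>+ y. ennreal (p y) \<partial>lborel) \<partial>lborel)"
    by (simp add: normalized_density_def emeasure_density)
  also have "\<dots> = (\<integral>\<^sup>+ x. ennreal (p x) \<partial>lborel) / (\<integral>\<^sup>+ y. ennreal (p y) \<partial>lborel)"
    by (rule nn_integral_divide) measurable
  also have "\<dots> = 1"
    using Z by (simp add: ennreal_divide_self less_top)
  finally show "emeasure (normalized_density p) (space (normalized_density p)) = 1" .
qed

lemma nn_integral_normalized_density:
  fixes p :: "'a::euclidean_space \<Rightarrow> real"
  assumes [measurable]: "p \<in> borel_measurable borel" "f \<in> borel_measurable borel"
  shows "(\<integral>\<^sup>+ x. f x \<partial>normalized_density p) =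
    (\<integral>\<^sup>+ x. ennreal (p x) * f x \<partial>lborel) / (\<integral>\<^sup>+ x. ennreal (p x) \<partial>lborel)"
proof -
  have "(\<integral>\<^sup>+ x. f x \<partial>normalized_density p) =
      (\<integral>\<^sup>+ x. ennreal (p x) * f x / (\<integral>\<^sup>+ x. ennreal (p x) \<partial>lborel) \<partial>lborel)"
    by (simp add: normalized_density_def nn_integral_density divide_ennreal_def ac_simps)
  also have "\<dots> = (\<integral>\<^sup>+ x. ennreal (p x) * f x \<partial>lborel) / (\<integral>\<^sup>+ x. ennreal (p x) \<partial>lborel)"
    by (rule nn_integral_divide) measurable
  finally show ?thesis .
qed

lemma mh_kernel_invariant:
  fixes p :: "'a::euclidean_space \<Rightarrow> real"
  assumes p: "p \<in> borel_measurable borel" "\<And>x. 0 \<le> p x"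
    and q: "(\<lambda>(x, y). q x y) \<in> borel_measurable (borel \<Otimes>\<^sub>M borel)" "\<And>x y. 0 \<le> q x y"
    and one: "\<And>x. p x \<noteq> 0 \<Longrightarrow> (\<integral>\<^sup>+ y. ennreal (q x y) \<partial>lborel) = 1"
    and P: "P \<in> borel \<rightarrow>\<^sub>M prob_algebra borel" "\<And>x. p x \<noteq> 0 \<Longrightarrow> P x = mh_kernel p q x"
  shows "bind (normalized_density p) P = normalized_density p"
proof (rule measure_eqI)
  let ?\<mu> = "normalized_density p"
  have \<mu>: "sets ?\<mu> = sets borel" "space ?\<mu> \<noteq> {}" by (simp_all add: normalized_density_def)
  have P': "P \<in> ?\<mu> \<rightarrow>\<^sub>M subprob_algebra borel"
    using measurable_prob_algebraD[OF P(1)] by (simp add: \<mu> cong: measurable_cong_sets)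
  show s: "sets (bind ?\<mu> P) = sets ?\<mu>"
    using sets_bind_measurable[OF P' \<mu>(2)] \<mu> by simp
  fix S assume "S \<in> sets (bind ?\<mu> P)"
  then have S [measurable]: "S \<in> sets borel" using s \<mu> by simp
  have em: "(\<lambda>x. emeasure (P x) S) \<in> borel_measurable borel"
    using measurable_compose[OF measurable_prob_algebraD[OF P(1)] measurable_emeasure_subprob_algebra[OF S]] .
  have "emeasure (bind ?\<mu> P) S = (\<integral>\<^sup>+ x. emeasure (P x) S \<partial>?\<mu>)"
    using emeasure_bind[OF \<mu>(2) P' S] .
  also have "\<dots> = (\<integral>\<^sup>+ x. ennreal (p x) * emeasure (P x) S \<partial>lborel) / (\<integral>\<^sup>+ x. ennreal (p x) \<partial>lborel)"
    by (rule nn_integral_normalized_density[OF p(1) em])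
  also have "(\<integral>\<^sup>+ x. ennreal (p x) * emeasure (P x) S \<partial>lborel) =
      (\<integral>\<^sup>+ x. ennreal (p x) * (\<integral>\<^sup>+ z. indicator S z \<partial>mh_kernel p q x) \<partial>lborel)"
  proof (intro nn_integral_cong)
    show "ennreal (p x) * emeasure (P x) S = ennreal (p x) * (\<integral>\<^sup>+ z. indicator S z \<partial>mh_kernel p q x)" for x
      using P(2)[of x] by (cases "p x = 0") (simp_all add: sets_mh_kernel)
  qed
  also have "\<dots> = (\<integral>\<^sup>+ x. ennreal (p x) * indicator S x \<partial>lborel)"
    by (rule nn_integral_mh_kernel_reversible[OF p q one]) measurable
  also have "\<dots> / (\<integral>\<^sup>+ x. ennreal (p x) \<partial>lborel) = (\<integral>\<^sup>+ x. indicator S x \<partial>?\<mu>)"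
    by (rule nn_integral_normalized_density[symmetric, OF p(1)]) measurable
  also have "\<dots> = emeasure ?\<mu> S" using \<mu> by simp
  finally show "emeasure (bind ?\<mu> P) S = emeasure ?\<mu> S" .
qed

section \<open>Polar coordinates and the radial form of the chain\<close>

lemma emeasure_cball_plane:
  assumes "0 \<le> r"
  shows "emeasure lborel (cball (0 :: real^2) r) = ennreal (pi * r\<^sup>2)"
  using emeasure_cball[OF assms, of "0 :: real^2"] by (simp add: eval_unit_ball_vol)

text \<open>Both measures give mass \<open>pi * a^2\<close> to \<open>{..a}\<close>.  The density needs no restriction to positive \<open>s\<close>
  because \<open>ennreal\<close> truncates negative values to 0.\<close>
lemma distr_norm_plane:
  "distr lborel borel (norm :: real^2 \<Rightarrow> real) = density lborel (\<lambda>s. ennreal (2 * pi * s))"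
proof -
  have eq: "emeasure (distr lborel borel (norm :: real^2 \<Rightarrow> real)) {..a} = ennreal (if 0 \<le> a then pi * a\<^sup>2 else 0)" for a
  proof -
    have "(norm :: real^2 \<Rightarrow> real) -` {..a} = cball 0 a" by auto
    then show ?thesis
      using emeasure_cball_plane[of a] by (auto simp: emeasure_distr not_le cball_empty)
  qed
  have eq': "emeasure (density lborel (\<lambda>s. ennreal (2 * pi * s))) {..a} = ennreal (if 0 \<le> a then pi * a\<^sup>2 else 0)" for a
  proof -
    have "emeasure (density lborel (\<lambda>s. ennreal (2 * pi * s))) {..a} =
        (\<integral>\<^sup>+ s. ennreal (2 * pi * s) * indicator {..a} s \<partial>lborel)"
      by (subst emeasure_density) auto
    also have "\<dots> = (\<integral>\<^sup>+ s. ennreal (2 * pi * s) * indicator {0..a} s \<partial>lborel)"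
      by (intro nn_integral_cong) (auto split: split_indicator simp: ennreal_eq_0_iff mult_le_0_iff)
    also have "\<dots> = ennreal (if 0 \<le> a then pi * a\<^sup>2 else 0)"
    proof (cases "0 \<le> a")
      case True
      have "(\<integral>\<^sup>+ s. ennreal (2 * pi * s) * indicator {0..a} s \<partial>lborel) = ennreal (pi * a\<^sup>2 - pi * 0\<^sup>2)"
        using True by (intro nn_integral_FTC_Icc) (auto intro!: derivative_eq_intros)
      then show ?thesis using True by simp
    qed auto
    finally show ?thesis .
  qed
  have borel: "sets (borel :: real measure) = sigma_sets UNIV (range atMost)"
    by (subst borel_eq_atMost) simp
  show ?thesis
  proof (rule measure_eqI_generator_eq[where E="range atMost" and \<Omega>=UNIV and A="\<lambda>i. {..real i}"])
    show "Int_stable (range (atMost :: real \<Rightarrow> real set))"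
      by (auto simp: Int_stable_def)
    show "(\<Union>i. {..real i}) = UNIV" by (auto intro: real_arch_simple)
  qed (auto simp: eq eq' borel)
qed

lemma nn_integral_radial:
  assumes [measurable]: "g \<in> borel_measurable borel"
  shows "(\<integral>\<^sup>+ y. g (norm (y :: real^2)) \<partial>lborel) = (\<integral>\<^sup>+ s. ennreal (2 * pi * s) * g s \<partial>lborel)"
proof -
  have "(\<integral>\<^sup>+ y. g (norm (y :: real^2)) \<partial>lborel) = (\<integral>\<^sup>+ s. g s \<partial>distr lborel borel (norm :: real^2 \<Rightarrow> real))"
    by (subst nn_integral_distr) auto
  then show ?thesis by (simp add: distr_norm_plane nn_integral_density)
qed

lemma norm_in_B: "y \<in> B x \<longleftrightarrow> \<bar>norm x - 1\<bar> < norm y \<and> norm y < norm x + 1"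
  by (simp add: B_def)

lemma B_sym: "y \<in> B x \<Longrightarrow> x \<in> B y"
  by (auto simp: B_def)

lemma B_nonzero: "y \<in> B x \<Longrightarrow> y \<noteq> 0"
  by (auto simp: B_def)

lemma proposal_density_nonneg: "0 \<le> proposal_density x y"
  by (simp add: proposal_density_def)

lemma proposal_density_measurable:
  "(\<lambda>(x, y). proposal_density x y) \<in> borel_measurable (borel \<Otimes>\<^sub>M borel)"
proof -
  have "(\<lambda>(x, y). proposal_density x y) =
     (\<lambda>(x, y). (if \<bar>norm x - 1\<bar> < norm y \<and> norm y < norm x + 1 then 1 else 0) / (4 * pi * norm x))"
    by (auto simp: fun_eq_iff proposal_density_def B_def)
  also have "\<dots> \<in> borel_measurable (borel \<Otimes>\<^sub>M borel)" by measurable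
  finally show ?thesis .
qed

lemma H_measurable [measurable]: "H \<in> borel_measurable borel"
  unfolding H_def[abs_def] by measurable

lemma target_density_measurable: "target_density \<in> borel_measurable borel"
  unfolding target_density_def[abs_def] by measurable

lemma target_density_nonneg: "0 \<le> target_density x"
  by (simp add: target_density_def)

lemma V_measurable: "V \<in> borel_measurable borel"
  unfolding V_def[abs_def] by measurable

text \<open>The endpoints of the interval form a null set; the closed interval is the form used by the
  fundamental theorem of calculus.\<close>
lemma nn_integral_proposal:
  assumes x: "x \<noteq> 0" and g: "g \<in> borel_measurable borel"
  shows "(\<integral>\<^sup>+ y. ennreal (proposal_density x y) * g (norm y) \<partial>lborel) =
    (\<integral>\<^sup>+ s. ennreal (s / (2 * norm x)) * g s * indicator {\<bar>norm x - 1\<bar>..norm x + 1} s \<partial>lborel)"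
proof -
  let ?I = "indicator {\<bar>norm x - 1\<bar><..<norm x + 1} :: real \<Rightarrow> real"
  have "(\<integral>\<^sup>+ y. ennreal (proposal_density x y) * g (norm y) \<partial>lborel) =
     (\<integral>\<^sup>+ y. ennreal (?I (norm y) / (4 * pi * norm x)) * g (norm (y :: real^2)) \<partial>lborel)"
    by (intro nn_integral_cong) (simp add: proposal_density_def norm_in_B indicator_def)
  also have "\<dots> = (\<integral>\<^sup>+ s. ennreal (2 * pi * s) * (ennreal (?I s / (4 * pi * norm x)) * g s) \<partial>lborel)"
    using g by (intro nn_integral_radial) measurable
  also have "\<dots> = (\<integral>\<^sup>+ s. ennreal (s / (2 * norm x)) * g s * indicator {\<bar>norm x - 1\<bar>..norm x + 1} s \<partial>lborel)"
  proof (rule nn_integral_cong_AE)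
    have "AE s in lborel. s \<noteq> \<bar>norm x - 1\<bar> \<and> s \<noteq> norm x + 1"
      by (intro eventually_conj AE_lborel_singleton)
    then show "AE s in lborel. ennreal (2 * pi * s) * (ennreal (?I s / (4 * pi * norm x)) * g s)
       = ennreal (s / (2 * norm x)) * g s * indicator {\<bar>norm x - 1\<bar>..norm x + 1} s"
    proof eventually_elim
      case (elim s)
      show ?case
      proof (cases "\<bar>norm x - 1\<bar> < s \<and> s < norm x + 1")
        case True
        then have "0 \<le> s" by linarith
        then have "ennreal (2 * pi * s) * ennreal (1 / (4 * pi * norm x)) = ennreal (s / (2 * norm x))"
          by (subst ennreal_mult[symmetric]) (auto simp: field_simps)
        then show ?thesis using True by (simp add: mult.assoc[symmetric])
      next
        case False
        then show ?thesis using elim by (auto simp: indicator_def)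
      qed
    qed
  qed
  finally show ?thesis .
qed

lemma nn_integral_chord:
  assumes r: "0 < r"
  shows "(\<integral>\<^sup>+ s. ennreal (s / (2 * r)) * indicator {\<bar>r - 1\<bar>..r + 1} s \<partial>lborel) = 1"
proof -
  have "(\<integral>\<^sup>+ s. ennreal (s / (2 * r)) * indicator {\<bar>r - 1\<bar>..r + 1} s \<partial>lborel)
     = ennreal ((r + 1)\<^sup>2 / (4 * r) - \<bar>r - 1\<bar>\<^sup>2 / (4 * r))"
    using r by (intro nn_integral_FTC_Icc) (auto intro!: derivative_eq_intros)
  also have "(r + 1)\<^sup>2 / (4 * r) - \<bar>r - 1\<bar>\<^sup>2 / (4 * r) = 1"
    using r by (simp add: field_simps power2_eq_square)
  finally show ?thesis by simp
qed

lemma proposal_density_normalized: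
  assumes "x \<noteq> 0"
  shows "(\<integral>\<^sup>+ y. ennreal (proposal_density x y) \<partial>lborel) = 1"
  using nn_integral_proposal[OF assms, of "\<lambda>_. 1"] nn_integral_chord[of "norm x"] assms by simp

text \<open>The radial profile of \<open>H\<close>.\<close>
definition h :: "real \<Rightarrow> real" where
  "h r = r + 1 / r"

lemma h_mono: "1 \<le> s \<Longrightarrow> s \<le> r \<Longrightarrow> h s \<le> h r"
proof -
  assume s: "1 \<le> s" and r: "s \<le> r"
  have "1 \<le> r * s" using s r mult_mono[of 1 r 1 s] by simp
  then have "0 \<le> (r - s) * (1 - 1 / (r * s))" using s r by (intro mult_nonneg_nonneg) (auto simp: field_simps)
  also have "\<dots> = h r - h s" using s r by (simp add: h_def field_simps)
  finally show ?thesis by simp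
qed

lemma h_diff: "r \<noteq> 0 \<Longrightarrow> s \<noteq> 0 \<Longrightarrow> h r - h s = (r - s) * (1 - 1 / (r * s))"
  by (simp add: h_def field_simps)

lemma h_le_iff_between:
  assumes "0 < a" "0 < r"
  shows "h r \<le> h a \<longleftrightarrow> (r - a) * (r - 1 / a) \<le> 0"
  using assms by (simp add: h_def field_simps)

lemma h_ge_2: "0 < r \<Longrightarrow> 2 \<le> h r"
proof -
  assume r: "0 < r"
  have "0 \<le> (r - 1)\<^sup>2 / r" using r by simp
  also have "\<dots> = h r - 2" using r by (simp add: h_def field_simps power2_eq_square)
  finally show ?thesis by simp
qed

definition accept :: "real \<Rightarrow> real \<Rightarrow> real" where
  "accept r s = min 1 (exp (h r - h s) * (r / s))"

lemma h_measurable [measurable]: "h \<in> borel_measurable borel"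
  unfolding h_def[abs_def] by measurable

lemma accept_measurable [measurable]: "accept r \<in> borel_measurable borel"
  unfolding accept_def[abs_def] by measurable

lemma mh_accept_annulus:
  assumes "x \<noteq> 0" "y \<in> B x"
  shows "mh_accept target_density proposal_density x y = accept (norm x) (norm y)"
proof -
  have "target_density y * proposal_density y x / (target_density x * proposal_density x y)
      = exp (- h (norm y)) / exp (- h (norm x)) * (norm x / norm y)"
    using assms B_nonzero[OF assms(2)] B_sym[OF assms(2)]
    by (simp add: target_density_def proposal_density_def H_def h_def)
  also have "exp (- h (norm y)) / exp (- h (norm x)) = exp (h (norm x) - h (norm y))"
    by (simp flip: exp_diff)
  finally show ?thesis by (simp add: mh_accept_def accept_def)
qed

text \<open>The proposal density of the radius times the expected ratio of \<open>V\<close> after and before the step,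
  since \<open>exp ((h s - h r) / 2)\<close> is the ratio for an accepted move.\<close>
definition drift_integrand :: "real \<Rightarrow> real \<Rightarrow> real" where
  "drift_integrand r s = s / (2 * r) * (1 + accept r s * (exp ((h s - h r) / 2) - 1))"

lemma accept_bounds: "0 < r \<Longrightarrow> 0 < s \<Longrightarrow> 0 \<le> accept r s" "accept r s \<le> 1"
  by (auto simp: accept_def)

section \<open>The drift condition\<close>

lemma nn_integral_V_annulus:
  assumes x: "x \<noteq> 0"
  shows "(\<integral>\<^sup>+ y. V y \<partial>mh_kernel target_density proposal_density x) =
    V x * (\<integral>\<^sup>+ s. ennreal (drift_integrand (norm x) s) * indicator {\<bar>norm x - 1\<bar>..norm x + 1} s \<partial>lborel)"
proof -
  let ?q = "proposal_density" and ?a = "mh_accept target_density proposal_density" and ?r = "norm x"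
  let ?G = "\<lambda>s. 1 + accept ?r s * (exp ((h s - h ?r) / 2) - 1)"
  have "(\<integral>\<^sup>+ y. V y \<partial>mh_kernel target_density ?q x) =
     (\<integral>\<^sup>+ y. ennreal (?q x y * ?a x y) * V y + ennreal (?q x y * (1 - ?a x y)) * V x \<partial>lborel)"
    by (intro nn_integral_mh_kernel target_density_measurable target_density_nonneg
        proposal_density_measurable proposal_density_nonneg V_measurable)
  also have "\<dots> = (\<integral>\<^sup>+ y. V x * (ennreal (?q x y) * ennreal (?G (norm y))) \<partial>lborel)"
  proof (rule nn_integral_cong)
    fix y
    show "ennreal (?q x y * ?a x y) * V y + ennreal (?q x y * (1 - ?a x y)) * V x
        = V x * (ennreal (?q x y) * ennreal (?G (norm y)))"
    proof (cases "y \<in> B x")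
      case False
      then show ?thesis by (simp add: proposal_density_def)
    next
      case True
      note y = B_nonzero[OF True]
      define A where "A = accept ?r (norm y)"
      have A: "0 \<le> A" "A \<le> 1" using x y by (simp_all add: A_def accept_bounds)
      define U where "U = exp ((h (norm y) - h ?r) / 2)"
      have Vy: "exp (H y / 2) = exp (H x / 2) * U"
        by (simp add: U_def H_def h_def diff_divide_distrib flip: exp_add)
      have G: "1 + A * (U - 1) = A * U + (1 - A)" by (simp add: algebra_simps)
      have "0 \<le> A * U + (1 - A)" using A by (auto simp: U_def)
      moreover have "ennreal (?q x y * A) * V y + ennreal (?q x y * (1 - A)) * V x
         = ennreal (?q x y * A * exp (H y / 2) + ?q x y * (1 - A) * exp (H x / 2))"
        using x y A proposal_density_nonneg[of x y]
        by (simp add: V_def ennreal_mult)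
      moreover have "?q x y * A * exp (H y / 2) + ?q x y * (1 - A) * exp (H x / 2)
          = exp (H x / 2) * (?q x y * (A * U + (1 - A)))"
        by (simp add: Vy algebra_simps)
      moreover have "V x * (ennreal (?q x y) * ennreal (A * U + (1 - A)))
          = ennreal (exp (H x / 2) * (?q x y * (A * U + (1 - A))))"
        using x proposal_density_nonneg[of x y] by (simp add: V_def ennreal_mult')
      ultimately show ?thesis
        unfolding mh_accept_annulus[OF x True] A_def[symmetric] U_def[symmetric] G by (simp only:)
    qed
  qed
  also have "\<dots> = V x * (\<integral>\<^sup>+ y. ennreal (?q x y) * ennreal (?G (norm y)) \<partial>lborel)"
  proof (rule nn_integral_cmult)
    have [measurable]: "(\<lambda>y. ?q x y) \<in> borel_measurable borel"
      using measurable_compose[OF measurable_Pair1' proposal_density_measurable, of x] by simp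
    show "(\<lambda>y. ennreal (?q x y) * ennreal (?G (norm y))) \<in> borel_measurable lborel"
      by measurable
  qed
  also have "(\<integral>\<^sup>+ y. ennreal (?q x y) * ennreal (?G (norm y)) \<partial>lborel) =
     (\<integral>\<^sup>+ s. ennreal (s / (2 * ?r)) * ennreal (?G s) * indicator {\<bar>?r - 1\<bar>..?r + 1} s \<partial>lborel)"
    by (intro nn_integral_proposal x) measurable
  also have "\<dots> = (\<integral>\<^sup>+ s. ennreal (drift_integrand ?r s) * indicator {\<bar>?r - 1\<bar>..?r + 1} s \<partial>lborel)"
  proof (intro nn_integral_cong)
    fix s
    show "ennreal (s / (2 * ?r)) * ennreal (?G s) * indicator {\<bar>?r - 1\<bar>..?r + 1} s =
       ennreal (drift_integrand ?r s) * indicator {\<bar>?r - 1\<bar>..?r + 1} s"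
    proof (cases "s \<in> {\<bar>?r - 1\<bar>..?r + 1}")
      case True
      then have "0 \<le> s" by auto
      then have "ennreal (s / (2 * ?r) * ?G s) = ennreal (s / (2 * ?r)) * ennreal (?G s)"
        by (intro ennreal_mult') simp
      then show ?thesis by (simp only: drift_integrand_def)
    qed simp
  qed
  finally show ?thesis .
qed

text \<open>With \<open>U\<close> the ratio of \<open>V\<close> at the proposal to \<open>V\<close> at the current point, the acceptance probability is at
  most \<open>r / s / U^2\<close>, and \<open>(U - 1) / U^2 \<le> 1 / 4\<close>.\<close>
lemma drift_integrand_le_bounded:
  assumes "0 < r" "0 \<le> s"
  shows "drift_integrand r s \<le> s / (2 * r) + 1 / 8"
proof (cases "s = 0")
  case False
  then have s: "0 < s" using assms by simp
  define U where "U = exp ((h s - h r) / 2)"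
  have U: "0 < U" by (simp add: U_def)
  have "accept r s \<le> exp (h r - h s) * (r / s)" by (simp add: accept_def)
  also have "exp (h r - h s) = 1 / U\<^sup>2"
  proof -
    have "U\<^sup>2 = exp (h s - h r)" by (simp add: U_def flip: exp_double)
    then show ?thesis by (simp add: exp_diff)
  qed
  finally have acc: "accept r s \<le> r / s / U\<^sup>2" by (simp add: mult.commute)
  have "accept r s * (U - 1) \<le> r / s / 4"
  proof (cases "1 \<le> U")
    case True
    have "accept r s * (U - 1) \<le> r / s / U\<^sup>2 * (U - 1)" using acc True by (intro mult_right_mono) auto
    also have "\<dots> = r / s * ((U - 1) / U\<^sup>2)" by simp
    also have "(U - 1) / U\<^sup>2 \<le> 1 / 4"
      using U zero_le_power2[of "U - 2"] by (simp add: field_simps power2_eq_square)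
    then have "r / s * ((U - 1) / U\<^sup>2) \<le> r / s * (1 / 4)" using assms s by (intro mult_left_mono) auto
    finally show ?thesis by simp
  next
    case False
    then have "accept r s * (U - 1) \<le> 0"
      using accept_bounds(1)[of r s] assms s by (auto intro: mult_nonneg_nonpos)
    also have "0 \<le> r / s / 4" using assms s by simp
    finally show ?thesis .
  qed
  then have "s / (2 * r) * (1 + accept r s * (U - 1)) \<le> s / (2 * r) * (1 + r / s / 4)"
    using assms s by (intro mult_left_mono) auto
  also have "\<dots> = s / (2 * r) + 1 / 8" using assms s by (simp add: field_simps)
  finally show ?thesis by (simp add: drift_integrand_def U_def)
qed (simp add: drift_integrand_def)

lemma integral_drift_bounded:
  assumes r: "0 < r"
  shows "(\<integral>\<^sup>+ s. ennreal (drift_integrand r s) * indicator {\<bar>r - 1\<bar>..r + 1} s \<partial>lborel) \<le> ennreal (5 / 4)"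
proof -
  have "(\<integral>\<^sup>+ s. ennreal (drift_integrand r s) * indicator {\<bar>r - 1\<bar>..r + 1} s \<partial>lborel)
     \<le> (\<integral>\<^sup>+ s. ennreal (s / (2 * r) + 1 / 8) * indicator {\<bar>r - 1\<bar>..r + 1} s \<partial>lborel)"
    using drift_integrand_le_bounded[OF r]
    by (intro nn_integral_mono) (auto split: split_indicator intro!: ennreal_leI)
  also have "\<dots> = ennreal (((r + 1)\<^sup>2 / (4 * r) + (r + 1) / 8) - (\<bar>r - 1\<bar>\<^sup>2 / (4 * r) + \<bar>r - 1\<bar> / 8))"
    using r by (intro nn_integral_FTC_Icc) (auto intro!: derivative_eq_intros add_nonneg_nonneg)
  also have "\<dots> \<le> ennreal (5 / 4)"
  proof (rule ennreal_leI)
    have sum: "u + a / 8 - (v + b / 8) \<le> 5 / 4" if "u - v = 1" "a - b \<le> 2" for u v a b :: real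
      using that by linarith
    have "(r + 1)\<^sup>2 / (4 * r) - \<bar>r - 1\<bar>\<^sup>2 / (4 * r) = 1"
      using r by (simp add: field_simps power2_eq_square)
    then show "((r + 1)\<^sup>2 / (4 * r) + (r + 1) / 8) - (\<bar>r - 1\<bar>\<^sup>2 / (4 * r) + \<bar>r - 1\<bar> / 8) \<le> 5 / 4"
      by (rule sum) (use abs_ge_self[of "r - 1"] in linarith)
  qed
  finally show ?thesis .
qed

text \<open>For small \<open>r\<close> the current point has \<open>h r \<ge> 17/4\<close>, while all proposals have \<open>h s \<le> 25/12\<close>.  The factor
  \<open>r / s\<close> in the acceptance ratio may tend to 0, but \<open>exp (1 / r) * r \<ge> 1\<close> compensates for it.\<close>
lemma near_origin:
  assumes r: "0 < r" "r < 1 / 4" and s: "1 - r \<le> s" "s \<le> 1 + r"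
  shows "1 / 30 \<le> accept r s" "exp ((h s - h r) / 2) \<le> 1 / 2"
proof -
  have hs: "h s \<le> 25 / 12"
  proof -
    have "(s - 3 / 4) * (s - 4 / 3) \<le> 0" using r s by (intro mult_nonneg_nonpos) auto
    then have "h s \<le> h (3 / 4)" using r s by (subst h_le_iff_between) auto
    then show ?thesis by (simp add: h_def)
  qed
  have e: "exp 1 < (272 / 100 :: real)" by (rule e_less_272)
  have hr: "17 / 4 \<le> h r"
  proof -
    have "0 < (r - 1 / 4) * (r - 4)" using r by (intro mult_neg_neg) auto
    then have "\<not> h r \<le> h (1 / 4)" using r by (subst h_le_iff_between) auto
    then show ?thesis by (simp add: h_def)
  qed
  have "exp ((h s - h r) / 2) \<le> exp (- 1)" using hs hr by simp
  also have "\<dots> \<le> 1 / 2" using exp_ge_add_one_self[of "1::real"] by (simp add: exp_minus field_simps)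
  finally show "exp ((h s - h r) / 2) \<le> 1 / 2" .
  have "exp 3 = exp (1::real) ^ 3" by (simp flip: exp_of_nat_mult)
  also have "\<dots> \<le> (272 / 100) ^ 3" using e by (intro power_mono) auto
  also have "\<dots> \<le> 24" by (simp add: power3_eq_cube)
  finally have e3: "1 / 24 \<le> exp (- 3 :: real)" by (simp add: exp_minus field_simps)
  have "1 / r \<le> exp (1 / r)" using exp_ge_add_one_self[of "1 / r"] by linarith
  then have er: "1 \<le> exp (1 / r) * r" using r by (simp add: field_simps)
  have "1 / 30 \<le> 1 * (1 / 24) * (4 / 5 :: real)" by simp
  also have "\<dots> \<le> exp (1 / r) * r * exp (- 3) * (1 / s)"
    using er e3 r s by (intro mult_mono) (auto simp: field_simps)
  also have "\<dots> = exp (1 / r - 3) * (r / s)" by (simp add: exp_diff exp_minus field_simps)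
  also have "\<dots> \<le> exp (h r - h s) * (r / s)"
    using r s hs by (intro mult_right_mono) (auto simp: h_def)
  finally show "1 / 30 \<le> accept r s" by (simp add: accept_def)
qed

lemma integral_drift_near_origin:
  assumes r: "0 < r" "r < 1 / 4"
  shows "(\<integral>\<^sup>+ s. ennreal (drift_integrand r s) * indicator {\<bar>r - 1\<bar>..r + 1} s \<partial>lborel) \<le> ennreal 0.995"
proof -
  have bound: "drift_integrand r s \<le> 0.995 * (s / (2 * r))" if "s \<in> {\<bar>r - 1\<bar>..r + 1}" for s
  proof -
    have s: "1 - r \<le> s" "s \<le> 1 + r" "0 \<le> s" using that r by auto
    have "1 / 30 * (1 / 2) \<le> accept r s * (1 - exp ((h s - h r) / 2))"
      using near_origin[OF r s(1,2)] by (intro mult_mono) auto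
    then have "1 + accept r s * (exp ((h s - h r) / 2) - 1) \<le> 0.995" by (simp add: algebra_simps)
    then have "s / (2 * r) * (1 + accept r s * (exp ((h s - h r) / 2) - 1)) \<le> s / (2 * r) * 0.995"
      using r s by (intro mult_left_mono) auto
    then show ?thesis by (simp add: drift_integrand_def mult.commute)
  qed
  have "(\<integral>\<^sup>+ s. ennreal (drift_integrand r s) * indicator {\<bar>r - 1\<bar>..r + 1} s \<partial>lborel)
    \<le> (\<integral>\<^sup>+ s. ennreal 0.995 * (ennreal (s / (2 * r)) * indicator {\<bar>r - 1\<bar>..r + 1} s) \<partial>lborel)"
  proof (intro nn_integral_mono)
    fix s
    show "ennreal (drift_integrand r s) * indicator {\<bar>r - 1\<bar>..r + 1} s
       \<le> ennreal 0.995 * (ennreal (s / (2 * r)) * indicator {\<bar>r - 1\<bar>..r + 1} s)"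
      using ennreal_leI[OF bound[of s]] ennreal_mult'[of "0.995" "s / (2 * r)"]
      by (cases "s \<in> {\<bar>r - 1\<bar>..r + 1}") (simp_all del: times_divide_eq_left times_divide_eq_right)
  qed
  also have "\<dots> = ennreal 0.995 * (\<integral>\<^sup>+ s. ennreal (s / (2 * r)) * indicator {\<bar>r - 1\<bar>..r + 1} s \<partial>lborel)"
    by (rule nn_integral_cmult) measurable
  also have "\<dots> = ennreal 0.995" using nn_integral_chord[OF r(1)] by simp
  finally show ?thesis .
qed

text \<open>Inward moves are accepted with certainty.  The constants come from \<open>h r - h s = (r - s) (1 - 1 / (r s))\<close>
  with \<open>r s \<ge> 12\<close>, which gives the slope \<open>11/12\<close>, halved in the exponent, and from
  \<open>s / r \<ge> 1 - (r - s) / 4\<close>.\<close>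
lemma drift_integrand_inward:
  assumes r: "4 < r" and s: "r - 1 \<le> s" "s \<le> r"
  shows "drift_integrand r s \<le> s / (2 * r) - 1 / 2 * ((1 - (r - s) / 4) * (1 - exp (- (11 / 24 * (r - s)))))"
proof -
  have hr: "11 / 12 * (r - s) \<le> h r - h s"
  proof -
    have "4 * 3 \<le> r * s" using r s by (intro mult_mono) auto
    then have "11 / 12 \<le> 1 - 1 / (r * s)" by (simp add: field_simps)
    then have "(r - s) * (11 / 12) \<le> (r - s) * (1 - 1 / (r * s))" using s by (intro mult_left_mono) auto
    then show ?thesis using r s by (simp add: h_diff)
  qed
  have "1 * 1 \<le> exp (h r - h s) * (r / s)"
    using r s hr by (intro mult_mono) (auto simp: field_simps)
  then have acc: "accept r s = 1" by (simp add: accept_def)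
  have "1 - (r - s) / 4 \<le> s / r"
  proof -
    have "0 \<le> (r - s) * (r - 4)" using r s by (intro mult_nonneg_nonneg) auto
    then show ?thesis using r by (simp add: field_simps)
  qed
  moreover have "1 - exp (- (11 / 24 * (r - s))) \<le> 1 - exp ((h s - h r) / 2)"
  proof -
    have "11 / 24 * (r - s) \<le> (h r - h s) / 2" using hr by (simp add: field_simps)
    moreover have "(h s - h r) / 2 = - ((h r - h s) / 2)" by (simp add: field_simps)
    ultimately have "(h s - h r) / 2 \<le> - (11 / 24 * (r - s))" by (simp only: neg_le_iff_le)
    then show ?thesis by (intro diff_left_mono) (simp only: exp_le_cancel_iff)
  qed
  ultimately have "(1 - (r - s) / 4) * (1 - exp (- (11 / 24 * (r - s)))) \<le> s / r * (1 - exp ((h s - h r) / 2))"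
    using r s by (intro mult_mono) auto
  moreover have "drift_integrand r s = s / (2 * r) - 1 / 2 * (s / r * (1 - exp ((h s - h r) / 2)))"
    by (simp add: drift_integrand_def acc right_diff_distrib)
  ultimately show ?thesis by linarith
qed

lemma exp_minus_half_ge: "1 / 2 \<le> exp (- (1 / 2 :: real))"
  using exp_ge_add_one_self[of "- (1 / 2) :: real"] by simp

text \<open>Bounding the acceptance probability by the second argument of the minimum leaves \<open>(a - a^2) / 2\<close> with
  \<open>a = exp (- (h s - h r) / 2)\<close>.  The function \<open>a - a^2\<close> decreases for \<open>a \<ge> 1/2\<close>, so \<open>a\<close> may be replaced by
  the smaller number \<open>exp (- (s - r) / 2)\<close>, which is still at least \<open>1/2\<close>.\<close>
lemma drift_integrand_outward:
  assumes r: "4 < r" and s: "r \<le> s" "s \<le> r + 1"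
  shows "drift_integrand r s \<le> s / (2 * r) + 1 / 2 * (exp (- ((s - r) / 2)) - exp (- (s - r)))"
proof -
  define a where "a = exp (- ((h s - h r) / 2))"
  define b where "b = exp (- ((s - r) / 2))"
  have h0: "0 \<le> h s - h r" using r s h_mono[of r s] by simp
  have h1: "h s - h r \<le> s - r"
  proof -
    have "(s - r) * (1 - 1 / (s * r)) \<le> (s - r) * 1"
      using r s by (intro mult_left_mono) auto
    then show ?thesis using r s by (simp add: h_diff)
  qed
  have a: "0 < a" "a \<le> 1" using h0 by (auto simp: a_def)
  have ba: "b \<le> a" using h1 by (simp add: a_def b_def)
  have "exp (- (1 / 2)) \<le> b" unfolding b_def using s by simp
  then have b: "1 / 2 \<le> b" using exp_minus_half_ge by simp
  have aa: "exp (h r - h s) = a * a" and bb: "exp (- (s - r)) = b * b"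
    by (simp_all add: a_def b_def add_divide_distrib diff_divide_distrib flip: exp_add)
  have ia: "exp ((h s - h r) / 2) = 1 / a"
    by (simp add: a_def exp_minus field_simps)
  have "accept r s \<le> a * a * (r / s)" unfolding accept_def aa by simp
  then have "accept r s * (1 / a - 1) \<le> a * a * (r / s) * (1 / a - 1)"
    using a by (intro mult_right_mono) auto
  also have "\<dots> = r / s * (a - a * a)" using a r s by (simp add: field_simps)
  also have "\<dots> \<le> r / s * (b - b * b)"
  proof (rule mult_left_mono)
    have "(a - b) * (1 - (a + b)) \<le> 0" using ba b by (intro mult_nonneg_nonpos) auto
    then show "a - a * a \<le> b - b * b" by (simp add: algebra_simps)
  qed (use r s in auto)
  finally have "s / (2 * r) * (1 + accept r s * (1 / a - 1)) \<le> s / (2 * r) * (1 + r / s * (b - b * b))"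
    using r s by (intro mult_left_mono add_left_mono) auto
  also have "\<dots> = s / (2 * r) + 1 / 2 * (b - b * b)" using r s by (simp add: field_simps)
  finally show ?thesis unfolding drift_integrand_def ia bb b_def[symmetric] .
qed

text \<open>The two summands are the integrals, over the inward and the outward half, of the preceding bounds
  on \<open>drift_integrand r s - s / (2 * r)\<close>; the true value of the left-hand side is about \<open>-0.0053\<close>.  Lower bounds for \<open>p\<close> and \<open>q\<close>
  follow from \<open>e < 2.72\<close> because \<open>p^2 = exp (- 1)\<close> and \<open>q^24 = exp (- 1)^11\<close>.\<close>
lemma far_drift_numeric:
  "1 / 2 * (120 / 121 - (7 / 8 + 54 / 121 * exp (- (11 / 24)))) + 1 / 2 * (1 - 2 * exp (- (1 / 2)) + exp (- 1))
     \<le> - (5 / 1000 :: real)"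
proof -
  define p where "p = exp (- (1 / 2) :: real)"
  define q where "q = exp (- (11 / 24) :: real)"
  have e: "100 / 272 < exp (- 1 :: real)" using e_less_272 by (simp add: exp_minus field_simps)
  have pp: "exp (- 1) = p\<^sup>2" by (simp add: p_def flip: exp_double)
  have p: "6063 / 10000 \<le> p"
  proof (rule ccontr)
    assume "\<not> ?thesis"
    then have "p\<^sup>2 < (6063 / 10000)\<^sup>2" by (intro power_strict_mono) (auto simp: p_def)
    then show False using e pp by (simp add: power2_eq_square)
  qed
  have p1: "p \<le> 1" by (simp add: p_def)
  have q: "632 / 1000 \<le> q"
  proof (rule ccontr)
    assume "\<not> ?thesis"
    then have "q ^ 24 < (632 / 1000) ^ 24" by (intro power_strict_mono) (auto simp: q_def)
    also have "\<dots> \<le> (100 / 272) ^ 11" by (simp add: power_divide)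
    also have "\<dots> \<le> exp (- 1) ^ 11" using e by (intro power_mono) auto
    also have "\<dots> = q ^ 24" by (simp add: q_def flip: exp_of_nat_mult)
    finally show False by simp
  qed
  have "1 - 2 * p + p\<^sup>2 = (1 - p)\<^sup>2" by (simp add: power2_eq_square algebra_simps)
  also have "\<dots> \<le> (1 - 6063 / 10000)\<^sup>2" using p p1 by (intro power_mono) auto
  also have "\<dots> \<le> 155 / 1000" by (simp add: power2_eq_square)
  finally have "1 - 2 * p + p\<^sup>2 \<le> 155 / 1000" .
  then show ?thesis using q unfolding p_def[symmetric] q_def[symmetric] pp by (auto simp: field_simps)
qed

lemma integral_drift_far:
  assumes r: "4 < r"
  shows "(\<integral>\<^sup>+ s. ennreal (drift_integrand r s) * indicator {\<bar>r - 1\<bar>..r + 1} s \<partial>lborel) \<le> ennreal 0.995"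
proof -
  let ?f = "\<lambda>s. s / (2 * r) - 1 / 2 * ((1 - (r - s) / 4) * (1 - exp (- (11 / 24 * (r - s)))))"
  let ?g = "\<lambda>s. s / (2 * r) + 1 / 2 * (exp (- ((s - r) / 2)) - exp (- (s - r)))"
  (* ?A is an antiderivative of (1 - t / 4) (1 - exp (- 11 t / 24)). *)
  let ?A = "\<lambda>t::real. t - t\<^sup>2 / 8 + exp (- (11 / 24 * t)) * (24 / 11 - 24 / 44 * t - 144 / 121)"
  let ?F = "\<lambda>s. s\<^sup>2 / (4 * r) + 1 / 2 * ?A (r - s)"
  let ?G = "\<lambda>s. s\<^sup>2 / (4 * r) + 1 / 2 * (exp (- (s - r)) - 2 * exp (- ((s - r) / 2)))"
  have "(\<integral>\<^sup>+ s. ennreal (drift_integrand r s) * indicator {\<bar>r - 1\<bar>..r + 1} s \<partial>lborel)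
    \<le> (\<integral>\<^sup>+ s. ennreal (?f s) * indicator {r - 1..r} s + ennreal (?g s) * indicator {r..r + 1} s \<partial>lborel)"
  proof (intro nn_integral_mono)
    fix s
    consider "s \<in> {r - 1..r}" | "s \<in> {r..r + 1}" | "s \<notin> {\<bar>r - 1\<bar>..r + 1}" using r by fastforce
    then show "ennreal (drift_integrand r s) * indicator {\<bar>r - 1\<bar>..r + 1} s
      \<le> ennreal (?f s) * indicator {r - 1..r} s + ennreal (?g s) * indicator {r..r + 1} s"
    proof cases
      case 1
      then have "ennreal (drift_integrand r s) \<le> ennreal (?f s)"
        using drift_integrand_inward[OF r] by (intro ennreal_leI) auto
      then show ?thesis using 1 r by (auto intro: add_increasing2)
    next
      case 2
      then have "ennreal (drift_integrand r s) \<le> ennreal (?g s)"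
        using drift_integrand_outward[OF r] by (intro ennreal_leI) auto
      then show ?thesis using 2 r by (auto intro: add_increasing)
    qed simp
  qed
  also have "\<dots> = (\<integral>\<^sup>+ s. ennreal (?f s) * indicator {r - 1..r} s \<partial>lborel)
      + (\<integral>\<^sup>+ s. ennreal (?g s) * indicator {r..r + 1} s \<partial>lborel)"
    by (rule nn_integral_add) measurable
  also have "(\<integral>\<^sup>+ s. ennreal (?f s) * indicator {r - 1..r} s \<partial>lborel) = ennreal (?F r - ?F (r - 1))"
  proof (intro nn_integral_FTC_Icc)
    fix s assume "s \<in> {r - 1..r}"
    then have s: "r - 1 \<le> s" "s \<le> r" by auto
    show "(?F has_real_derivative ?f s) (at s)"
      using r by (auto intro!: derivative_eq_intros simp: field_simps)
    have "(1 - (r - s) / 4) * (1 - exp (- (11 / 24 * (r - s)))) \<le> (1 - (r - s) / 4) * (1 - (1 - 11 / 24 * (r - s)))"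
    proof (rule mult_left_mono)
      show "1 - exp (- (11 / 24 * (r - s))) \<le> 1 - (1 - 11 / 24 * (r - s))"
        using exp_ge_add_one_self[of "- (11 / 24 * (r - s))"] by linarith
    qed (use s in simp)
    also have "\<dots> \<le> 1 * (11 / 24)" using s by (intro mult_mono) auto
    also have "\<dots> \<le> s / r" using r s by (simp add: field_simps)
    finally show "0 \<le> ?f s" by simp
  qed (use r in auto)
  also have "(\<integral>\<^sup>+ s. ennreal (?g s) * indicator {r..r + 1} s \<partial>lborel) = ennreal (?G (r + 1) - ?G r)"
  proof (intro nn_integral_FTC_Icc)
    fix s assume "s \<in> {r..r + 1}"
    then have s: "r \<le> s" "s \<le> r + 1" by auto
    show "(?G has_real_derivative ?g s) (at s)"
      using r by (auto intro!: derivative_eq_intros simp: field_simps)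
    have "- (s - r) \<le> - ((s - r) / 2)" using s by argo
    then have "exp (- (s - r)) \<le> exp (- ((s - r) / 2))" by (simp only: exp_le_cancel_iff)
    then show "0 \<le> ?g s" using r s by (intro add_nonneg_nonneg) auto
  qed (use r in auto)
  also have "ennreal (?F r - ?F (r - 1)) + ennreal (?G (r + 1) - ?G r) \<le> ennreal 0.995"
  proof -
    have sq: "r\<^sup>2 / (4 * r) - (r - 1)\<^sup>2 / (4 * r) = (2 * r - 1) / (4 * r)"
      "(r + 1)\<^sup>2 / (4 * r) - r\<^sup>2 / (4 * r) = (2 * r + 1) / (4 * r)"
      using r by (simp_all add: field_simps power2_eq_square)
    have A: "?A (r - r) = 120 / 121" "?A (r - (r - 1)) = 7 / 8 + 54 / 121 * exp (- (11 / 24))"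
      by simp_all
    have F: "?F r - ?F (r - 1) = (2 * r - 1) / (4 * r) + 1 / 2 * (120 / 121 - (7 / 8 + 54 / 121 * exp (- (11 / 24))))"
      unfolding A using sq(1) by (simp only: right_diff_distrib)
    have G: "?G (r + 1) - ?G r = (2 * r + 1) / (4 * r) + 1 / 2 * (1 - 2 * exp (- (1 / 2)) + exp (- 1))"
      using sq(2) by (simp add: algebra_simps)
    have e: "exp (- (11 / 24)) \<le> (1 :: real)" "exp (- (1 / 2)) \<le> (1 :: real)" "0 < exp (- 1 :: real)" by simp_all
    have "7 / 16 \<le> (2 * r - 1) / (4 * r)" "1 / 2 \<le> (2 * r + 1) / (4 * r)" using r by (simp_all add: field_simps)
    moreover have "0 \<le> u + 1 / 2 * (120 / 121 - (7 / 8 + 54 / 121 * q))" if "7 / 16 \<le> u" "q \<le> 1" for u q :: real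
      using that by (simp add: field_simps)
    moreover have "0 \<le> u + 1 / 2 * (1 - 2 * p + q)" if "1 / 2 \<le> u" "p \<le> 1" "0 < q" for u p q :: real
      using that by (simp add: field_simps)
    ultimately have "0 \<le> ?F r - ?F (r - 1)" "0 \<le> ?G (r + 1) - ?G r"
      unfolding F G using e by blast+
    then have "ennreal (?F r - ?F (r - 1)) + ennreal (?G (r + 1) - ?G r) =
        ennreal ((?F r - ?F (r - 1)) + (?G (r + 1) - ?G r))"
      by (rule ennreal_plus[symmetric])
    also have "\<dots> \<le> ennreal 0.995"
    proof (rule ennreal_leI)
      have "(2 * r - 1) / (4 * r) + (2 * r + 1) / (4 * r) = 1" using r by (simp add: field_simps)
      moreover have "u + v + (w + z) \<le> 0.995" if "u + w = 1" "v + z \<le> - (5 / 1000)" for u v w z :: real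
        using that by (simp add: field_simps)
      ultimately show "(?F r - ?F (r - 1)) + (?G (r + 1) - ?G r) \<le> 0.995"
        unfolding F G using far_drift_numeric by blast
    qed
    finally show ?thesis .
  qed
  finally show ?thesis .
qed

section \<open>The chain and its stationary distribution\<close>

lemma annulus_chain_kernel:
  assumes "prob_space P0" "sets P0 = sets borel"
  shows "annulus_chain P0 \<in> borel \<rightarrow>\<^sub>M prob_algebra borel"
proof -
  have "annulus_chain P0 = (\<lambda>x. if x \<in> {0} then P0 else mh_kernel target_density proposal_density x)"
    by (simp add: annulus_chain_def fun_eq_iff)
  also have "\<dots> \<in> borel \<rightarrow>\<^sub>M prob_algebra borel"
    using assms proposal_density_normalized
    by (intro mh_kernel_measurable target_density_measurable target_density_nonneg
        proposal_density_measurable proposal_density_nonneg) auto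
  finally show ?thesis .
qed

lemma nn_integral_exp_norm_finite:
  "(\<integral>\<^sup>+ y. ennreal (exp (- (norm (y :: real^2) / 2))) \<partial>lborel) < \<infinity>"
proof -
  have "(\<integral>\<^sup>+ y. ennreal (exp (- (norm (y :: real^2) / 2))) \<partial>lborel)
      = (\<integral>\<^sup>+ s. ennreal (2 * pi * s) * ennreal (exp (- (s / 2))) \<partial>lborel)"
    by (rule nn_integral_radial) measurable
  also have "\<dots> \<le> (\<integral>\<^sup>+ s. ennreal (8 * pi * exp (- (s / 4))) * indicator {0..} s \<partial>lborel)"
  proof (intro nn_integral_mono)
    fix s :: real
    show "ennreal (2 * pi * s) * ennreal (exp (- (s / 2))) \<le> ennreal (8 * pi * exp (- (s / 4))) * indicator {0..} s"
    proof (cases "0 \<le> s")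
      case True
      have "s / 4 \<le> exp (s / 4)" using exp_ge_add_one_self[of "s / 4"] by linarith
      then have "s * exp (- (s / 2)) \<le> 4 * exp (s / 4) * exp (- (s / 2))" by (intro mult_right_mono) auto
      also have "\<dots> = 4 * exp (- (s / 4))" by (simp flip: exp_add)
      finally have "2 * pi * (s * exp (- (s / 2))) \<le> 2 * pi * (4 * exp (- (s / 4)))"
        by (intro mult_left_mono) auto
      then show ?thesis using True by (simp add: ac_simps flip: ennreal_mult)
    next
      case False
      then have "2 * pi * s \<le> 0" by (intro mult_nonneg_nonpos) auto
      then have "ennreal (2 * pi * s) = 0" by (simp only: ennreal_eq_0_iff)
      then show ?thesis by simp
    qed
  qed
  also have "\<dots> = ennreal (0 - (- (32 * pi) * exp (- (0 / 4))))"
  proof (rule nn_integral_FTC_atLeast)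
    have "filterlim (\<lambda>s::real. s / 4) at_top at_top"
      by (rule filterlim_at_top_mult_tendsto_pos[of "\<lambda>_. 1 / 4" "1 / 4", simplified]) (auto intro: filterlim_ident)
    then have "filterlim (\<lambda>s::real. - (s / 4)) at_bot at_top"
      by (simp add: filterlim_uminus_at_top)
    then have "((\<lambda>s::real. exp (- (s / 4))) \<longlongrightarrow> 0) at_top"
      by (rule filterlim_compose[OF exp_at_bot])
    then show "((\<lambda>s::real. - (32 * pi) * exp (- (s / 4))) \<longlongrightarrow> 0) at_top"
      by (rule tendsto_mult_right_zero)
  qed (auto intro!: derivative_eq_intros)
  finally show ?thesis by (auto simp: less_top intro: order.strict_trans1)
qed

lemma norm_le_H: "norm x \<le> H x"
  by (simp add: H_def)

lemma target_density_le: "target_density x \<le> exp (- (norm x / 2))"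
proof -
  have "norm x / 2 \<le> H x" using norm_le_H[of x] norm_ge_zero[of x] by linarith
  then show ?thesis by (simp add: target_density_def)
qed

lemma target_density_total:
  "(\<integral>\<^sup>+ x. ennreal (target_density x) \<partial>lborel) \<noteq> 0"
  "(\<integral>\<^sup>+ x. ennreal (target_density x) \<partial>lborel) < \<infinity>"
proof -
  have "(\<integral>\<^sup>+ x. ennreal (target_density x) \<partial>lborel) \<le> (\<integral>\<^sup>+ y. ennreal (exp (- (norm (y :: real^2) / 2))) \<partial>lborel)"
    by (intro nn_integral_mono ennreal_leI target_density_le)
  then show "(\<integral>\<^sup>+ x. ennreal (target_density x) \<partial>lborel) < \<infinity>"
    using nn_integral_exp_norm_finite by (rule order.strict_trans1)
  show "(\<integral>\<^sup>+ x. ennreal (target_density x) \<partial>lborel) \<noteq> 0"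
  proof
    assume "(\<integral>\<^sup>+ x. ennreal (target_density x) \<partial>lborel) = 0"
    then have "AE x in lborel. ennreal (target_density x) = 0"
      using target_density_measurable by (subst (asm) nn_integral_0_iff_AE) auto
    with AE_lborel_singleton[of "0 :: real^2"] have "AE x in lborel :: (real^2) measure. False"
      by eventually_elim (auto simp: target_density_def)
    then show False by (simp add: ae_filter_eq_bot_iff eventually_False)
  qed
qed

text \<open>Away from the origin, the product of \<open>V\<close> with the target density is \<open>exp (- H / 2)\<close>.\<close>
lemma V_integral_finite: "(\<integral>\<^sup>+ x. V x \<partial>normalized_density target_density) < \<infinity>"
proof -
  have "(\<integral>\<^sup>+ x. ennreal (target_density x) * V x \<partial>lborel)
     \<le> (\<integral>\<^sup>+ y. ennreal (exp (- (norm (y :: real^2) / 2))) \<partial>lborel)"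
  proof (intro nn_integral_mono)
    fix x :: "real^2"
    show "ennreal (target_density x) * V x \<le> ennreal (exp (- (norm x / 2)))"
    proof (cases "x = 0")
      case False
      then have "ennreal (target_density x) * V x = ennreal (exp (- (H x / 2)))"
        by (simp add: target_density_def V_def flip: ennreal_mult exp_add)
      also have "\<dots> \<le> ennreal (exp (- (norm x / 2)))" by (intro ennreal_leI) (simp add: H_def)
      finally show ?thesis .
    qed (simp add: target_density_def)
  qed
  then have "(\<integral>\<^sup>+ x. ennreal (target_density x) * V x \<partial>lborel) < \<infinity>"
    using nn_integral_exp_norm_finite by (rule order.strict_trans1)
  then show ?thesis
    using target_density_total
    by (simp add: nn_integral_normalized_density[OF target_density_measurable V_measurable]
        ennreal_divide_eq_top_iff less_top[symmetric])
qed

section \<open>Minorization\<close>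

definition annulus :: "real \<Rightarrow> real \<Rightarrow> (real^2) set" where
  "annulus a b = {z. a < norm z \<and> norm z < b}"

lemma annulus_sets [measurable]: "annulus a b \<in> sets borel"
  unfolding annulus_def by measurable

lemma emeasure_annulus:
  assumes "0 \<le> a" "a \<le> b"
  shows "emeasure lborel (annulus a b) = ennreal (pi * (b\<^sup>2 - a\<^sup>2))"
proof -
  have "emeasure lborel (annulus a b) = (\<integral>\<^sup>+ y. indicator {a<..<b} (norm (y :: real^2)) \<partial>lborel)"
  proof -
    have "(\<integral>\<^sup>+ y. indicator {a<..<b} (norm (y :: real^2)) \<partial>lborel) = (\<integral>\<^sup>+ y. indicator (annulus a b) y \<partial>lborel)"
      by (intro nn_integral_cong) (auto simp: annulus_def indicator_def)
    then show ?thesis by simp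
  qed
  also have "\<dots> = (\<integral>\<^sup>+ s. ennreal (2 * pi * s) * indicator {a<..<b} s \<partial>lborel)"
    by (rule nn_integral_radial) measurable
  also have "\<dots> = (\<integral>\<^sup>+ s. ennreal (2 * pi * s) * indicator {a..b} s \<partial>lborel)"
  proof (rule nn_integral_cong_AE)
    have "AE s in lborel. s \<noteq> a \<and> s \<noteq> b" by (intro eventually_conj AE_lborel_singleton)
    then show "AE s in lborel. ennreal (2 * pi * s) * indicator {a<..<b} s = ennreal (2 * pi * s) * indicator {a..b} s"
      by eventually_elim (auto simp: indicator_def)
  qed
  also have "\<dots> = ennreal (pi * b\<^sup>2 - pi * a\<^sup>2)"
    using assms by (intro nn_integral_FTC_Icc) (auto intro!: derivative_eq_intros)
  finally show ?thesis by (simp add: right_diff_distrib)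
qed

text \<open>The Lebesgue density of an accepted move between points of norms \<open>r\<close> and \<open>s\<close>.\<close>
definition move_density :: "real \<Rightarrow> real \<Rightarrow> real" where
  "move_density r s = accept r s / (4 * pi * r)"

text \<open>Multiplied by \<open>4 * pi\<close>, the density is the minimum of the two upper bounds on \<open>k\<close>.\<close>
lemma move_density_ge:
  assumes "0 < r" "0 < s" "k \<le> 1 / r" "k \<le> exp (h r - h s) / s"
  shows "k / (4 * pi) \<le> move_density r s"
proof -
  have "k * r \<le> 1" "k * r \<le> exp (h r - h s) * (r / s)"
    using assms by (simp_all add: field_simps)
  then have "k * r \<le> accept r s" by (simp add: accept_def)
  then have "k \<le> accept r s / r" using assms by (simp add: field_simps)
  then have "k / (4 * pi) \<le> accept r s / r / (4 * pi)" by (intro divide_right_mono) auto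
  then show ?thesis by (simp add: move_density_def ac_simps)
qed

lemma nn_integral_annulus_chain_ge:
  assumes x: "x \<noteq> 0" and c: "0 \<le> c" and A: "A \<in> sets borel"
    and dens: "\<And>y. y \<in> A \<Longrightarrow> y \<in> B x \<and> c \<le> move_density (norm x) (norm y)"
    and f: "f \<in> borel_measurable borel"
  shows "ennreal c * (\<integral>\<^sup>+ y. f y * indicator A y \<partial>lborel) \<le> (\<integral>\<^sup>+ y. f y \<partial>annulus_chain P0 x)"
proof -
  let ?q = "proposal_density" and ?a = "mh_accept target_density proposal_density"
  have "ennreal c * (\<integral>\<^sup>+ y. f y * indicator A y \<partial>lborel) = (\<integral>\<^sup>+ y. ennreal c * (f y * indicator A y) \<partial>lborel)"
    using f A by (intro nn_integral_cmult[symmetric] borel_measurable_times_ennreal borel_measurable_indicator) auto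
  also have "\<dots> \<le> (\<integral>\<^sup>+ y. ennreal (?q x y * ?a x y) * f y + ennreal (?q x y * (1 - ?a x y)) * f x \<partial>lborel)"
  proof (intro nn_integral_mono)
    fix y
    show "ennreal c * (f y * indicator A y)
      \<le> ennreal (?q x y * ?a x y) * f y + ennreal (?q x y * (1 - ?a x y)) * f x"
    proof (cases "y \<in> A")
      case True
      have "?q x y * ?a x y = move_density (norm x) (norm y)"
        using dens[OF True] mh_accept_annulus[OF x] by (simp add: proposal_density_def move_density_def)
      then have "ennreal c * f y \<le> ennreal (?q x y * ?a x y) * f y"
        using dens[OF True] by (intro mult_right_mono ennreal_leI) auto
      then show ?thesis using True by (auto intro: add_increasing2)
    qed simp
  qed
  also have "\<dots> = (\<integral>\<^sup>+ y. f y \<partial>annulus_chain P0 x)"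
    using x nn_integral_mh_kernel[OF target_density_measurable target_density_nonneg
        proposal_density_measurable proposal_density_nonneg f]
    by (simp add: annulus_chain_def)
  finally show ?thesis .
qed

lemma emeasure_annulus_chain_ge:
  assumes P0: "prob_space P0" "sets P0 = sets borel"
    and x: "x \<noteq> 0" and c: "0 \<le> c" and A: "A \<in> sets borel" and S: "S \<in> sets borel"
    and dens: "\<And>y. y \<in> A \<Longrightarrow> y \<in> B x \<and> c \<le> move_density (norm x) (norm y)"
  shows "ennreal c * emeasure lborel (S \<inter> A) \<le> emeasure (annulus_chain P0 x) S"
proof -
  have "ennreal c * (\<integral>\<^sup>+ y. indicator S y * indicator A y \<partial>lborel) \<le> (\<integral>\<^sup>+ y. indicator S y \<partial>annulus_chain P0 x)"
    using S by (intro nn_integral_annulus_chain_ge x c A dens) auto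
  moreover have "(\<integral>\<^sup>+ y. indicator S y * indicator A y \<partial>lborel) = emeasure lborel (S \<inter> A)"
    using S A by (simp add: indicator_inter_arith[symmetric] nn_integral_indicator)
  ultimately show ?thesis
    using S by (simp add: kernel_prob_space(2)[OF annulus_chain_kernel[OF P0]])
qed

text \<open>Only the paths whose intermediate point lies in \<open>annulus a b\<close> are counted.\<close>
lemma two_step_ge:
  assumes P0: "prob_space P0" "sets P0 = sets borel"
    and x: "x \<noteq> 0" and c: "0 \<le> c" "0 \<le> c'" and ab: "0 < a" "a \<le> b"
    and A': "A' \<in> sets borel" and S: "S \<in> sets borel"
    and first: "\<And>y. y \<in> annulus a b \<Longrightarrow> y \<in> B x \<and> c \<le> move_density (norm x) (norm y)"
    and second: "\<And>y z. y \<in> annulus a b \<Longrightarrow> z \<in> A' \<Longrightarrow> z \<in> B y \<and> c' \<le> move_density (norm y) (norm z)"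
  shows "ennreal (c * c' * (pi * (b\<^sup>2 - a\<^sup>2))) * emeasure lborel (S \<inter> A')
       \<le> emeasure (kernel_power (annulus_chain P0) 2 x) S"
proof -
  let ?P = "annulus_chain P0"
  note P = annulus_chain_kernel[OF P0]
  have sq: "0 \<le> b\<^sup>2 - a\<^sup>2" using ab by simp
  have "ennreal (c * c' * (pi * (b\<^sup>2 - a\<^sup>2))) * emeasure lborel (S \<inter> A')
     = ennreal c * (ennreal c' * emeasure lborel (S \<inter> A') * emeasure lborel (annulus a b))"
    using c ab sq by (simp add: emeasure_annulus ennreal_mult ac_simps)
  also have "\<dots> = ennreal c * (\<integral>\<^sup>+ y. ennreal c' * emeasure lborel (S \<inter> A') * indicator (annulus a b) y \<partial>lborel)"
    by (subst nn_integral_cmult_indicator) simp_all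
  also have "\<dots> \<le> ennreal c * (\<integral>\<^sup>+ y. emeasure (?P y) S * indicator (annulus a b) y \<partial>lborel)"
  proof (intro mult_left_mono nn_integral_mono)
    fix y
    show "ennreal c' * emeasure lborel (S \<inter> A') * indicator (annulus a b) y
        \<le> emeasure (?P y) S * indicator (annulus a b) y"
    proof (cases "y \<in> annulus a b")
      case True
      then have "y \<noteq> 0" using ab by (auto simp: annulus_def)
      then show ?thesis
        using emeasure_annulus_chain_ge[OF P0 _ c(2) A' S second[OF True]] True by simp
    qed simp
  qed simp
  also have "\<dots> \<le> (\<integral>\<^sup>+ y. emeasure (?P y) S \<partial>?P x)"
    using emeasure_kernel_measurable[OF P S]
    by (intro nn_integral_annulus_chain_ge x c(1) annulus_sets first) auto
  also have "\<dots> = emeasure (kernel_power ?P 2 x) S"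
    using emeasure_kernel_power_Suc[OF P S, of 1 x] kernel_power_1[OF P] by (simp add: numeral_2_eq_2)
  finally show ?thesis .
qed

text \<open>Two steps change the radius by less than 2 and can only reach radii below \<open>9/4\<close> from radius \<open>1/4\<close>
  and above \<open>2\<close> from radius \<open>4\<close>; the target annulus must lie in between.\<close>
definition target_annulus :: "(real^2) set" where
  "target_annulus = annulus (33 / 16) (17 / 8)"

lemma move_density_to_small:
  assumes r: "1 / 4 \<le> r" "r \<le> 17 / 8" and s: "9 / 8 < s" "s < 5 / 4"
  shows "(47 / 100) / (4 * pi) \<le> move_density r s"
proof (rule move_density_ge)
  have "h s \<le> h (5 / 4)" using s by (intro h_mono) auto
  then have "- (1 / 20) \<le> h r - h s" using h_ge_2[of r] r by (simp add: h_def)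
  then have "19 / 20 \<le> exp (h r - h s)" using exp_ge_add_one_self[of "h r - h s"] by linarith
  then have "(19 / 20) / (5 / 4) \<le> exp (h r - h s) / s" using s by (intro frac_le) auto
  then show "47 / 100 \<le> exp (h r - h s) / s" by (rule order_trans[rotated]) simp
  show "47 / 100 \<le> 1 / r" using r by (simp add: field_simps)
qed (use r s in auto)

lemma move_density_to_target:
  assumes s: "9 / 8 < s" "s < 5 / 4" and u: "33 / 16 < u" "u < 17 / 8"
  shows "(18 / 100) / (4 * pi) \<le> move_density s u"
proof (rule move_density_ge)
  have "h u \<le> h (17 / 8)" using u by (intro h_mono) auto
  then have "- (3 / 5) \<le> h s - h u" using h_ge_2[of s] s by (simp add: h_def)
  then have "2 / 5 \<le> exp (h s - h u)" using exp_ge_add_one_self[of "h s - h u"] by linarith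
  then have "(2 / 5) / (17 / 8) \<le> exp (h s - h u) / u" using u by (intro frac_le) auto
  then show "18 / 100 \<le> exp (h s - h u) / u" by simp
  show "18 / 100 \<le> 1 / s" using s by (simp add: field_simps)
qed (use s u in auto)

lemma move_density_from_far:
  assumes r: "17 / 8 \<le> r" "r \<le> 4" and s: "3 < s" "s < 49 / 16"
  shows "(65 / 1000) / (4 * pi) \<le> move_density r s"
proof (rule move_density_ge)
  have "h s \<le> h (49 / 16)" "h (17 / 8) \<le> h r" using r s by (auto intro!: h_mono)
  then have "- (4 / 5) \<le> h r - h s" by (simp add: h_def)
  then have "1 / 5 \<le> exp (h r - h s)" using exp_ge_add_one_self[of "h r - h s"] by linarith
  then have "(1 / 5) / (49 / 16) \<le> exp (h r - h s) / s" using s by (intro frac_le) auto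
  then show "65 / 1000 \<le> exp (h r - h s) / s" by simp
  show "65 / 1000 \<le> 1 / r" using r by (simp add: field_simps)
qed (use r s in auto)

lemma move_density_from_far_to_target:
  assumes s: "3 < s" "s < 49 / 16" and u: "33 / 16 < u" "u < 17 / 8"
  shows "(32 / 100) / (4 * pi) \<le> move_density s u"
proof (rule move_density_ge)
  have "h u \<le> h s" using u s by (intro h_mono) auto
  then have "1 \<le> exp (h s - h u)" by simp
  then have "1 / (17 / 8) \<le> exp (h s - h u) / u" using u by (intro frac_le) auto
  then show "32 / 100 \<le> exp (h s - h u) / u" by simp
  show "32 / 100 \<le> 1 / s" using s by (simp add: field_simps)
qed (use s u in auto)

definition minorizing_measure :: "(real^2) measure" where
  "minorizing_measure = uniform_measure lborel target_annulus"

lemma emeasure_target_annulus: "emeasure lborel target_annulus = ennreal (67 / 256 * pi)"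
  unfolding target_annulus_def by (subst emeasure_annulus) (auto simp: power2_eq_square field_simps)

lemma target_annulus_sets: "target_annulus \<in> sets borel"
  by (simp add: target_annulus_def annulus_sets)

lemma minorizing_measure: "prob_space minorizing_measure" "sets minorizing_measure = sets borel"
proof -
  have "emeasure lborel target_annulus \<noteq> 0"
    unfolding emeasure_target_annulus ennreal_eq_0_iff using pi_gt_zero by linarith
  then show "prob_space minorizing_measure"
    unfolding minorizing_measure_def
    by (rule prob_space_uniform_measure) (simp add: emeasure_target_annulus)
qed (simp add: minorizing_measure_def)

text \<open>The factor \<open>67 / 256 * pi\<close> is the area of the target annulus.  Dividing \<open>d\<close> by \<open>pi\<close> matches the product of
  two densities \<open>1 / (4 * pi)\<close> with the area of the intermediate annulus.\<close>
lemma minorizing_measure_scaled: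
  assumes S: "S \<in> sets borel" and d: "0 \<le> e" "e * 256 / 67 \<le> d"
  shows "ennreal e * emeasure minorizing_measure S \<le> ennreal (d / pi) * emeasure lborel (S \<inter> target_annulus)"
proof -
  have "ennreal e * emeasure minorizing_measure S =
     ennreal e / ennreal (67 / 256 * pi) * emeasure lborel (S \<inter> target_annulus)"
    using S target_annulus_sets
    by (simp add: minorizing_measure_def emeasure_target_annulus divide_ennreal_def Int_commute ac_simps)
  also have "ennreal e / ennreal (67 / 256 * pi) = ennreal (e / (67 / 256 * pi))"
    using d by (intro divide_ennreal) auto
  also have "e / (67 / 256 * pi) = (e * 256 / 67) / pi" by simp
  also have "ennreal \<dots> \<le> ennreal (d / pi)" using d by (intro ennreal_leI divide_right_mono) auto
  finally show ?thesis by (simp add: mult_right_mono)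
qed

lemma two_step_minorization:
  assumes P0: "prob_space P0" "sets P0 = sets borel" and x: "x \<in> C" and S: "S \<in> sets borel"
  shows "ennreal (3.5 / 10 ^ 5) * emeasure minorizing_measure S \<le> emeasure (kernel_power (annulus_chain P0) 2 x) S"
proof -
  have r: "1 / 4 \<le> norm x" "norm x \<le> 4" and x0: "x \<noteq> 0" using x by (auto simp: C_def)
  show ?thesis
  proof (cases "norm x \<le> 17 / 8")
    case True
    let ?d = "(47 / 100) * (18 / 100) * ((5 / 4)\<^sup>2 - (9 / 8)\<^sup>2) / 16 :: real"
    have "ennreal (3.5 / 10 ^ 5) * emeasure minorizing_measure S \<le> ennreal (?d / pi) * emeasure lborel (S \<inter> target_annulus)"
      by (intro minorizing_measure_scaled S) (simp_all add: power2_eq_square)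
    also have "?d / pi = (47 / 100) / (4 * pi) * ((18 / 100) / (4 * pi)) * (pi * ((5 / 4)\<^sup>2 - (9 / 8)\<^sup>2))"
      by simp
    also have "ennreal \<dots> * emeasure lborel (S \<inter> target_annulus) \<le> emeasure (kernel_power (annulus_chain P0) 2 x) S"
    proof (rule two_step_ge[OF P0 x0 _ _ _ _ target_annulus_sets S])
      show "y \<in> B x \<and> (47 / 100) / (4 * pi) \<le> move_density (norm x) (norm y)"
        if "y \<in> annulus (9 / 8) (5 / 4)" for y
        using that move_density_to_small[of "norm x" "norm y"] r True by (auto simp: annulus_def B_def)
      show "z \<in> B y \<and> (18 / 100) / (4 * pi) \<le> move_density (norm y) (norm z)"
        if "y \<in> annulus (9 / 8) (5 / 4)" "z \<in> target_annulus" for y z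
        using that move_density_to_target[of "norm y" "norm z"] by (auto simp: annulus_def target_annulus_def B_def)
    qed auto
    finally show ?thesis .
  next
    case False
    let ?d = "(65 / 1000) * (32 / 100) * ((49 / 16)\<^sup>2 - 3\<^sup>2) / 16 :: real"
    have "ennreal (3.5 / 10 ^ 5) * emeasure minorizing_measure S \<le> ennreal (?d / pi) * emeasure lborel (S \<inter> target_annulus)"
      by (intro minorizing_measure_scaled S) (simp_all add: power2_eq_square)
    also have "?d / pi = (65 / 1000) / (4 * pi) * ((32 / 100) / (4 * pi)) * (pi * ((49 / 16)\<^sup>2 - 3\<^sup>2))"
      by simp
    also have "ennreal \<dots> * emeasure lborel (S \<inter> target_annulus) \<le> emeasure (kernel_power (annulus_chain P0) 2 x) S"
    proof (rule two_step_ge[OF P0 x0 _ _ _ _ target_annulus_sets S])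
      show "y \<in> B x \<and> (65 / 1000) / (4 * pi) \<le> move_density (norm x) (norm y)"
        if "y \<in> annulus 3 (49 / 16)" for y
        using that move_density_from_far[of "norm x" "norm y"] r False by (auto simp: annulus_def B_def)
      show "z \<in> B y \<and> (32 / 100) / (4 * pi) \<le> move_density (norm y) (norm z)"
        if "y \<in> annulus 3 (49 / 16)" "z \<in> target_annulus" for y z
        using that move_density_from_far_to_target[of "norm y" "norm z"] by (auto simp: annulus_def target_annulus_def B_def)
    qed auto
    finally show ?thesis .
  qed
qed

definition shell :: "real \<Rightarrow> (real^2) set" where
  "shell R = {y. 1 / 4 \<le> norm y \<and> norm y \<le> R}"

lemma shell_sets [measurable]: "shell R \<in> sets borel"
  unfolding shell_def by measurable

text \<open>Three regimes: below radius \<open>1/4\<close> all proposals lie in the shell and are accepted with probability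
  at least \<open>1 / 30\<close>; up to \<open>17/8\<close> the annulus of radii \<open>9/8\<close> to \<open>5/4\<close> is reached; beyond, a move
  inward by between \<open>1/2\<close> and \<open>1\<close> is always accepted.\<close>
lemma shell_step:
  assumes P0: "prob_space P0" "sets P0 = sets borel"
    and x: "x \<noteq> 0" and R: "4 \<le> R" "norm x \<le> R + 1 / 2"
  shows "ennreal (1 / 30) \<le> emeasure (annulus_chain P0 x) (shell R)"
proof -
  let ?P = "annulus_chain P0" and ?r = "norm x"
  have r: "0 < ?r" using x by simp
  consider "?r < 1 / 4" | "1 / 4 \<le> ?r" "?r \<le> 17 / 8" | "17 / 8 < ?r" by linarith
  then show ?thesis
  proof cases
    case 1
    let ?q = "proposal_density" and ?a = "mh_accept target_density proposal_density"
    have [measurable]: "(\<lambda>y. ?q x y) \<in> borel_measurable borel"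
      using measurable_compose[OF measurable_Pair1' proposal_density_measurable, of x] by simp
    have "ennreal (1 / 30) = (\<integral>\<^sup>+ y. ennreal (1 / 30) * ennreal (?q x y) \<partial>lborel)"
      using proposal_density_normalized[OF x] by (subst nn_integral_cmult) auto
    also have "\<dots> \<le> (\<integral>\<^sup>+ y. ennreal (?q x y * ?a x y) * indicator (shell R) y
        + ennreal (?q x y * (1 - ?a x y)) * indicator (shell R) x \<partial>lborel)"
    proof (intro nn_integral_mono)
      fix y
      show "ennreal (1 / 30) * ennreal (?q x y) \<le> ennreal (?q x y * ?a x y) * indicator (shell R) y
        + ennreal (?q x y * (1 - ?a x y)) * indicator (shell R) x"
      proof (cases "y \<in> B x")
        case True
        then have y: "y \<in> shell R" "1 - ?r \<le> norm y" "norm y \<le> 1 + ?r"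
          using 1 R by (auto simp: shell_def B_def)
        have "1 / 30 * ?q x y \<le> ?a x y * ?q x y"
          using near_origin(1)[OF r 1 y(2,3)] mh_accept_annulus[OF x True]
          by (intro mult_right_mono proposal_density_nonneg) simp
        then have "ennreal (1 / 30) * ennreal (?q x y) \<le> ennreal (?q x y * ?a x y)"
          using proposal_density_nonneg[of x y] by (simp add: mult.commute ennreal_leI flip: ennreal_mult)
        then show ?thesis using y by (auto intro: add_increasing2)
      qed (simp add: proposal_density_def)
    qed
    also have "\<dots> = emeasure (?P x) (shell R)"
      using x emeasure_mh_kernel[OF target_density_measurable target_density_nonneg
        proposal_density_measurable proposal_density_nonneg shell_sets]
      by (simp add: annulus_chain_def)
    finally show ?thesis .
  next
    case 2
    have "ennreal (1 / 30) \<le> ennreal ((47 / 100) / (4 * pi)) * emeasure lborel (shell R \<inter> annulus (9 / 8) (5 / 4))"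
    proof -
      have "shell R \<inter> annulus (9 / 8) (5 / 4) = annulus (9 / 8) (5 / 4)"
        using R by (auto simp: shell_def annulus_def)
      then have "ennreal ((47 / 100) / (4 * pi)) * emeasure lborel (shell R \<inter> annulus (9 / 8) (5 / 4))
          = ennreal ((47 / 100) / (4 * pi) * (pi * ((5 / 4)\<^sup>2 - (9 / 8)\<^sup>2)))"
        by (simp add: emeasure_annulus power2_eq_square flip: ennreal_mult)
      also have "ennreal (1 / 30) \<le> \<dots>" by (intro ennreal_leI) (simp add: power2_eq_square)
      finally show ?thesis .
    qed
    also have "\<dots> \<le> emeasure (?P x) (shell R)"
      using move_density_to_small[of ?r] 2 x
      by (intro emeasure_annulus_chain_ge P0 shell_sets annulus_sets) (auto simp: annulus_def B_def)
    finally show ?thesis .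
  next
    case 3
    have "ennreal (1 / 30) \<le> ennreal ((1 / ?r) / (4 * pi)) * emeasure lborel (shell R \<inter> annulus (?r - 1) (?r - 1 / 2))"
    proof -
      have "shell R \<inter> annulus (?r - 1) (?r - 1 / 2) = annulus (?r - 1) (?r - 1 / 2)"
        using R 3 by (auto simp: shell_def annulus_def)
      then have "ennreal ((1 / ?r) / (4 * pi)) * emeasure lborel (shell R \<inter> annulus (?r - 1) (?r - 1 / 2))
          = ennreal ((1 / ?r) / (4 * pi)) * ennreal (pi * ((?r - 1 / 2)\<^sup>2 - (?r - 1)\<^sup>2))"
        using 3 by (simp add: emeasure_annulus)
      also have "\<dots> = ennreal ((1 / ?r) / (4 * pi) * (pi * ((?r - 1 / 2)\<^sup>2 - (?r - 1)\<^sup>2)))"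
        by (rule ennreal_mult'[symmetric]) simp
      also have "(1 / ?r) / (4 * pi) * (pi * ((?r - 1 / 2)\<^sup>2 - (?r - 1)\<^sup>2)) = (?r - 3 / 4) / (4 * ?r)"
        using r by (simp add: power2_eq_square field_simps)
      also have "ennreal (1 / 30) \<le> ennreal ((?r - 3 / 4) / (4 * ?r))"
        using 3 r by (intro ennreal_leI) (simp add: field_simps)
      finally show ?thesis .
    qed
    also have "\<dots> \<le> emeasure (?P x) (shell R)"
    proof (intro emeasure_annulus_chain_ge P0 shell_sets annulus_sets x)
      fix y assume "y \<in> annulus (?r - 1) (?r - 1 / 2)"
      then have y: "?r - 1 < norm y" "norm y < ?r - 1 / 2" by (auto simp: annulus_def)
      have "h (norm y) \<le> h ?r" using 3 y by (intro h_mono) auto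
      then have "1 / ?r \<le> exp (h ?r - h (norm y)) / norm y"
        using 3 y by (intro frac_le) auto
      then have "(1 / ?r) / (4 * pi) \<le> move_density ?r (norm y)"
        using 3 y by (intro move_density_ge) auto
      then show "y \<in> B x \<and> (1 / ?r) / (4 * pi) \<le> move_density ?r (norm y)"
        using 3 y by (simp add: B_def)
    qed (use r in simp)
    finally show ?thesis .
  qed
qed

lemma shell_minorization:
  assumes P0: "prob_space P0" "sets P0 = sets borel"
    and "x \<in> shell (4 + real j / 2)" and S: "S \<in> sets borel"
  shows "ennreal ((1 / 30) ^ j * (3.5 / 10 ^ 5)) * emeasure minorizing_measure S
       \<le> emeasure (kernel_power (annulus_chain P0) (j + 2) x) S"
  using assms(3)
proof (induction j arbitrary: x)
  case 0
  then have "x \<in> C" by (simp add: shell_def C_def)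
  then show ?case using two_step_minorization[OF P0 _ S] by (simp only: power_0 mult_1 add_0)
next
  case (Suc j)
  have "ennreal (1 / 30 * ((1 / 30) ^ j * (3.5 / 10 ^ 5))) * emeasure minorizing_measure S
       \<le> emeasure (kernel_power (annulus_chain P0) (Suc (j + 2)) x) S"
  proof (rule minorization_extend[OF annulus_chain_kernel[OF P0] S shell_sets _ Suc.IH])
    show "ennreal (1 / 30) \<le> emeasure (annulus_chain P0 x) (shell (4 + real j / 2))"
      using Suc.prems by (intro shell_step P0) (auto simp: shell_def field_simps)
  qed auto
  then show ?case by (simp only: power_Suc mult.assoc add_Suc)
qed

text \<open>A bound on \<open>V\<close> bounds the norm from above, and one further step handles the points near the
  origin, which lie in no shell.\<close>
lemma sublevel_minorization:
  assumes P0: "prob_space P0" "sets P0 = sets borel"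
  shows "\<exists>m e Q. 0 < m \<and> 0 < e \<and> prob_space Q \<and> sets Q = sets borel \<and>
       (\<forall>x. V x \<le> ennreal R \<longrightarrow> (\<forall>S\<in>sets borel.
          ennreal e * emeasure Q S \<le> emeasure (kernel_power (annulus_chain P0) m x) S))"
proof -
  obtain j :: nat where j: "4 * \<bar>R\<bar> \<le> real j" using real_arch_simple by blast
  show ?thesis
  proof (intro exI[of _ "Suc (j + 2)"] exI[of _ "1 / 30 * ((1 / 30) ^ j * (3.5 / 10 ^ 5))"]
      exI[of _ minorizing_measure] conjI allI impI ballI)
    fix x :: "real^2" and S :: "(real^2) set" assume V: "V x \<le> ennreal R" and S: "S \<in> sets borel"
    have x: "x \<noteq> 0" using V by (auto simp: V_def top_unique)
    have "exp (H x / 2) \<le> \<bar>R\<bar>"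
      using V x by (simp add: V_def ennreal_le_iff2)
    moreover have "norm x / 2 \<le> exp (H x / 2)"
    proof -
      have "norm x / 2 \<le> exp (norm x / 2)" using exp_ge_add_one_self[of "norm x / 2"] by linarith
      also have "\<dots> \<le> exp (H x / 2)" using norm_le_H[of x] by simp
      finally show ?thesis .
    qed
    ultimately have "norm x \<le> (4 + real j / 2) + 1 / 2" using j by simp
    then show "ennreal (1 / 30 * ((1 / 30) ^ j * (3.5 / 10 ^ 5))) * emeasure minorizing_measure S
       \<le> emeasure (kernel_power (annulus_chain P0) (Suc (j + 2)) x) S"
      using x by (intro minorization_extend[OF annulus_chain_kernel[OF P0] S shell_sets]
          shell_minorization shell_step P0 S) auto
  qed (auto simp: minorizing_measure)
qed

section \<open>Drift and ergodicity of the annulus chain\<close>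

lemma V_bounded_on_C:
  assumes "x \<in> C"
  shows "(\<integral>\<^sup>+ y. V y \<partial>annulus_chain P0 x) \<le> ennreal (exp 2.7)"
proof -
  have r: "1 / 4 \<le> norm x" "norm x \<le> 4" and x: "x \<noteq> 0" using assms by (auto simp: C_def)
  have "(norm x - 4) * (norm x - 1 / 4) \<le> 0" using r by (intro mult_nonpos_nonneg) auto
  then have "h (norm x) \<le> h 4" using x by (subst h_le_iff_between) auto
  then have H: "H x \<le> 17 / 4" by (simp add: H_def h_def)
  have "(\<integral>\<^sup>+ y. V y \<partial>annulus_chain P0 x) \<le> V x * ennreal (5 / 4)"
    using x integral_drift_bounded[of "norm x"]
    by (simp add: annulus_chain_def nn_integral_V_annulus mult_left_mono)
  also have "\<dots> = ennreal (exp (H x / 2) * (5 / 4))" using x by (simp add: V_def flip: ennreal_mult')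
  also have "\<dots> \<le> ennreal (exp 2.7)"
  proof (rule ennreal_leI)
    have "5 / 4 \<le> exp (23 / 40 :: real)" using exp_ge_add_one_self[of "23 / 40 :: real"] by simp
    then have "exp (H x / 2) * (5 / 4) \<le> exp (17 / 8) * exp (23 / 40)" using H by (intro mult_mono) auto
    also have "\<dots> = exp 2.7" by (simp flip: exp_add)
    finally show "exp (H x / 2) * (5 / 4) \<le> exp 2.7" .
  qed
  finally show ?thesis .
qed

lemma drift_condition:
  "(\<integral>\<^sup>+ y. V y \<partial>annulus_chain P0 x) \<le> ennreal 0.995 * V x + ennreal (exp 2.7 - 0.995) * indicator C x"
proof -
  have e: "0.995 \<le> exp (2.7 :: real)" using exp_ge_add_one_self[of "2.7 :: real"] by simp
  consider "x = 0" | "x \<in> C" | "x \<noteq> 0" "norm x < 1 / 4 \<or> 4 < norm x" by (fastforce simp: C_def)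
  then show ?thesis
  proof cases
    case 1
    then show ?thesis by (simp add: V_def ennreal_mult_top)
  next
    case 2
    then have x: "x \<noteq> 0" by (auto simp: C_def)
    have "ennreal (exp 2.7) = ennreal 0.995 * 1 + ennreal (exp 2.7 - 0.995)"
      using e by (simp flip: ennreal_plus)
    also have "\<dots> \<le> ennreal 0.995 * V x + ennreal (exp 2.7 - 0.995)"
      using x by (intro add_mono mult_left_mono) (auto simp: V_def H_def ennreal_1[symmetric] simp del: ennreal_1 intro!: ennreal_leI)
    finally show ?thesis using V_bounded_on_C[OF 2, of P0] 2 by simp
  next
    case 3
    have "(\<integral>\<^sup>+ y. V y \<partial>annulus_chain P0 x) \<le> V x * ennreal 0.995"
      using 3 integral_drift_near_origin[of "norm x"] integral_drift_far[of "norm x"]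
      by (auto simp add: annulus_chain_def nn_integral_V_annulus intro!: mult_left_mono)
    then show ?thesis by (simp add: mult.commute add_increasing2)
  qed
qed

theorem theorem2:
  fixes P0 :: "(real^2) measure" and P :: "real^2 \<Rightarrow> (real^2) measure"
  assumes "prob_space P0" and "sets P0 = sets borel"
    and "P = annulus_chain P0"
  shows "(\<exists>Q. prob_space Q \<and> sets Q = sets (borel :: (real^2) measure) \<and>
            (\<forall>x\<in>C. \<forall>S\<in>sets borel.
               emeasure (kernel_power P 2 x) S \<ge> ennreal (3.5 / 10 ^ 5) * emeasure Q S)) \<and>
         (\<forall>x. (\<integral>\<^sup>+ y. V y \<partial>P x) \<le> ennreal 0.995 * V x + ennreal (exp 2.7 - 0.995) * indicator C x) \<and>
         (SUP x\<in>C. \<integral>\<^sup>+ y. V y \<partial>P x) \<le> ennreal (exp 2.7) \<and>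
         geometrically_ergodic P (normalized_density target_density)"
proof (intro conjI)
  note P0 = assms(1,2)
  have P: "P \<in> borel \<rightarrow>\<^sub>M prob_algebra borel" unfolding assms(3) by (rule annulus_chain_kernel[OF P0])
  show "\<exists>Q. prob_space Q \<and> sets Q = sets (borel :: (real^2) measure) \<and>
            (\<forall>x\<in>C. \<forall>S\<in>sets borel.
               emeasure (kernel_power P 2 x) S \<ge> ennreal (3.5 / 10 ^ 5) * emeasure Q S)"
    using minorizing_measure two_step_minorization[OF P0] unfolding assms(3) by blast
  show "\<forall>x. (\<integral>\<^sup>+ y. V y \<partial>P x) \<le> ennreal 0.995 * V x + ennreal (exp 2.7 - 0.995) * indicator C x"
    unfolding assms(3) using drift_condition by blast
  show "(SUP x\<in>C. \<integral>\<^sup>+ y. V y \<partial>P x) \<le> ennreal (exp 2.7)"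
    unfolding assms(3) by (intro SUP_least V_bounded_on_C)
  show "geometrically_ergodic P (normalized_density target_density)"
  proof (rule geometrically_ergodic_if_drift[OF P V_measurable])
    show "(\<integral>\<^sup>+ y. V y \<partial>P x) \<le> ennreal 0.995 * V x + ennreal (exp 2.7 - 0.995)" for x
      unfolding assms(3)
      by (rule order_trans[OF drift_condition]) (auto intro!: add_left_mono split: split_indicator)
    show "0 \<le> exp 2.7 - (0.995 :: real)" using exp_ge_add_one_self[of "2.7 :: real"] by simp
    show "\<exists>m e Q. 0 < m \<and> 0 < e \<and> prob_space Q \<and> sets Q = sets borel \<and>
       (\<forall>x. V x \<le> ennreal R \<longrightarrow> (\<forall>S\<in>sets borel.
          ennreal e * emeasure Q S \<le> emeasure (kernel_power P m x) S))" for R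
      unfolding assms(3) by (rule sublevel_minorization[OF P0])
    show "prob_space (normalized_density target_density)"
      by (rule prob_space_normalized_density[OF target_density_measurable target_density_total])
    show "bind (normalized_density target_density) P = normalized_density target_density"
    proof (rule mh_kernel_invariant[OF target_density_measurable target_density_nonneg
          proposal_density_measurable proposal_density_nonneg _ P])
      show "(\<integral>\<^sup>+ y. ennreal (proposal_density x y) \<partial>lborel) = 1" if "target_density x \<noteq> 0" for x
        using that proposal_density_normalized by (auto simp: target_density_def split: if_splits)
      show "P x = mh_kernel target_density proposal_density x" if "target_density x \<noteq> 0" for x
        using that by (auto simp: target_density_def assms(3) annulus_chain_def split: if_splits)
    qed
    show "(\<integral>\<^sup>+ x. V x \<partial>normalized_density target_density) < \<infinity>" by (rule V_integral_finite)
  qed (auto simp: normalized_density_def)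
qed

end
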